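(* There exists a rigid arrangement $\mathcal{O}_{33}$ of $33$ lines defined over the real numbers (i.e. in the real projective plane) such that $$n_{2} = 108, \quad n_{3} = 40, \quad n_{5} = 16, \quad n_{8}=5,$$ and all other $n_k$ vanish. The arrangement $\mathcal{O}_{33}$ (viewed as a complex plane curve) is free with exponents $(d_{1},d_{2}) = (15,17)$.
   Context: For a line arrangement $\mathcal{L}$ and $k\ge 2$, $n_k$ denotes the number of points where exactly $k$ lines of $\mathcal{L}$ meet. A line arrangement is rigid if its realization space (the moduli space of line arrangements with the same intersection lattice, i.e. the same incidences between lines and intersection points, up to the action of $\mathrm{PGL}_3$) is zero-dimensional. Let $S=\mathbb{C}[x,y,z]$ and let $C: f=0$ be a reduced plane curve of degree $d$, with Jacobian ideal $J_f=\langle \partial_x f,\partial_y f,\partial_z f\rangle$ and Milnor algebra $M(f)=S/J_f$. The curve $C$ is free with exponents $(d_1,d_2)$, $d_1\le d_2$, if $M(f)$ has a minimal graded free resolution of the form $0\to S(1-d-d_1)\oplus S(1-d-d_2)\to S^3(1-d)\to S\to M(f)\to 0$; then $d_1+d_2=d-1$. *)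

theory Defs
  imports "HOL-Analysis.Analysis"
begin

(* ---------- Line arrangements (lines = nonzero coefficient vectors in K^3) ---------- *)

definition cdot :: "complex^3 \<Rightarrow> complex^3 \<Rightarrow> complex" where
  "cdot u v = (\<Sum>k\<in>UNIV. u$k * v$k)"

definition concurrent :: "(nat \<Rightarrow> complex^3) \<Rightarrow> nat set \<Rightarrow> bool" where
  "concurrent L S \<longleftrightarrow> (\<exists>p. p \<noteq> 0 \<and> (\<forall>i\<in>S. cdot (L i) p = 0))"

definition line_arr :: "nat \<Rightarrow> (nat \<Rightarrow> complex^3) \<Rightarrow> bool" where
  "line_arr n L \<longleftrightarrow> (\<forall>i<n. L i \<noteq> 0) \<and>
      (\<forall>i<n. \<forall>j<n. i \<noteq> j \<longrightarrow> \<not> (\<exists>c. L i = c *s L j))"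

definition same_lattice :: "nat \<Rightarrow> (nat \<Rightarrow> complex^3) \<Rightarrow> (nat \<Rightarrow> complex^3) \<Rightarrow> bool" where
  "same_lattice n L M \<longleftrightarrow> (\<forall>S \<subseteq> {..<n}. concurrent L S \<longleftrightarrow> concurrent M S)"

definition proj_equiv :: "nat \<Rightarrow> (nat \<Rightarrow> complex^3) \<Rightarrow> (nat \<Rightarrow> complex^3) \<Rightarrow> bool" where
  "proj_equiv n L M \<longleftrightarrow> (\<exists>A::complex^3^3. invertible A \<and>
      (\<forall>i<n. \<exists>c. c \<noteq> 0 \<and> M i = c *s (A *v L i)))"

(* rigid: the realization space (arrangements with the same intersection lattice
   modulo PGL_3) is zero-dimensional, i.e. consists of finitely many points *)
definition rigid :: "nat \<Rightarrow> (nat \<Rightarrow> complex^3) \<Rightarrow> bool" where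
  "rigid n L \<longleftrightarrow> line_arr n L \<and>
     (\<exists>F. finite F \<and> (\<forall>M. line_arr n M \<and> same_lattice n L M \<longrightarrow>
                             (\<exists>M'\<in>F. proj_equiv n M' M)))"

definition cplx :: "(nat \<Rightarrow> real^3) \<Rightarrow> nat \<Rightarrow> complex^3" where
  "cplx L = (\<lambda>i. \<chi> k. complex_of_real (L i $ k))"

(* n_k: number of points of P^2(R) where exactly k of the lines meet.
   A point p is identified with the set of lines through it; for k >= 2
   distinct points give distinct sets. *)
definition nk :: "nat \<Rightarrow> (nat \<Rightarrow> real^3) \<Rightarrow> nat \<Rightarrow> nat" where
  "nk n L k = card {S. \<exists>p::real^3. p \<noteq> 0 \<and> S = {i. i < n \<and> L i \<bullet> p = 0} \<and> card S = k}"

type_synonym cfun3 = "complex \<times> complex \<times> complex \<Rightarrow> complex"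

definition poly3 :: "cfun3 \<Rightarrow> bool" where
  "poly3 p \<longleftrightarrow> (\<exists>k c. p = (\<lambda>(x,y,z). \<Sum>i\<le>k. \<Sum>j\<le>k. \<Sum>l\<le>k. c i j l * x^i * y^j * z^l))"

definition hpoly3 :: "nat \<Rightarrow> cfun3 \<Rightarrow> bool" where
  "hpoly3 d p \<longleftrightarrow> (\<exists>c. p = (\<lambda>(x,y,z). \<Sum>i\<le>d. \<Sum>j\<le>d. \<Sum>l\<le>d.
                          if i + j + l = d then c i j l * x^i * y^j * z^l else 0))"

definition dx :: "cfun3 \<Rightarrow> cfun3" where "dx f = (\<lambda>(x,y,z). deriv (\<lambda>t. f (t,y,z)) x)"
definition dy :: "cfun3 \<Rightarrow> cfun3" where "dy f = (\<lambda>(x,y,z). deriv (\<lambda>t. f (x,t,z)) y)"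
definition dz :: "cfun3 \<Rightarrow> cfun3" where "dz f = (\<lambda>(x,y,z). deriv (\<lambda>t. f (x,y,t)) z)"

definition arr_poly :: "nat \<Rightarrow> (nat \<Rightarrow> complex^3) \<Rightarrow> cfun3" where
  "arr_poly n L = (\<lambda>(x,y,z). \<Prod>i<n. L i $ 1 * x + L i $ 2 * y + L i $ 3 * z)"

definition syz :: "cfun3 \<Rightarrow> cfun3 \<times> cfun3 \<times> cfun3 \<Rightarrow> bool" where
  "syz f r \<longleftrightarrow> (case r of (a,b,c) \<Rightarrow> poly3 a \<and> poly3 b \<and> poly3 c \<and>
       (\<forall>p. a p * dx f p + b p * dy f p + c p * dz f p = 0))"

definition hom_triple :: "nat \<Rightarrow> cfun3 \<times> cfun3 \<times> cfun3 \<Rightarrow> bool" where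
  "hom_triple d r \<longleftrightarrow> (case r of (a,b,c) \<Rightarrow> hpoly3 d a \<and> hpoly3 d b \<and> hpoly3 d c)"

definition lincomb :: "cfun3 \<Rightarrow> cfun3 \<times> cfun3 \<times> cfun3 \<Rightarrow> cfun3 \<Rightarrow> cfun3 \<times> cfun3 \<times> cfun3
                        \<Rightarrow> cfun3 \<times> cfun3 \<times> cfun3" where
  "lincomb g1 r1 g2 r2 = (case r1 of (a1,b1,c1) \<Rightarrow> case r2 of (a2,b2,c2) \<Rightarrow>
      ((\<lambda>p. g1 p * a1 p + g2 p * a2 p), (\<lambda>p. g1 p * b1 p + g2 p * b2 p),
       (\<lambda>p. g1 p * c1 p + g2 p * c2 p)))"

(* Free with exponents (d1,d2): exactness of
   0 -> S(1-d-d1) + S(1-d-d2) -> S^3(1-d) -> S -> M(f) -> 0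
   means the module of Jacobian syzygies is free on homogeneous generators
   of degrees d1 and d2. *)
definition free_curve :: "cfun3 \<Rightarrow> nat \<Rightarrow> nat \<Rightarrow> bool" where
  "free_curve f d1 d2 \<longleftrightarrow> d1 \<le> d2 \<and>
     (\<exists>r1 r2. hom_triple d1 r1 \<and> hom_triple d2 r2 \<and> syz f r1 \<and> syz f r2 \<and>
        (\<forall>s. syz f s \<longrightarrow> (\<exists>!g. poly3 (fst g) \<and> poly3 (snd g) \<and>
                                 s = lincomb (fst g) r1 (snd g) r2)))"

end

theory Submission
  imports Defs
begin

text \<open>The arrangement consists of the line at infinity, the eight mirrors of the dihedral symmetry group of
  order 16, and the lines at distance \<open>1\<close>, \<open>\<surd>2 - 1\<close>, \<open>\<surd>2 + 1\<close> from the origin parallel to the mirrors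
  \<open>x = 0\<close>, \<open>y = 0\<close>, \<open>x = y\<close>, \<open>x = -y\<close>.

  Freeness follows from Saito's criterion: two fields of degrees 15 and 17 without \<open>z\<close>-component are tangent
  to all lines, so their determinant, of degree 32, is divisible by the product of the 32 affine lines, hence
  a nonzero multiple of it. Cramer's rule then expresses every tangent field in terms of these two and the
  Euler field.

  Rigidity: after fixing a projective frame, a realization has one free parameter \<open>t\<close>, the position of one
  more parallel of \<open>x = 0\<close>. A chain of joins and meets forces \<open>t (2 + t) = 1\<close>, and every other line is a join
  of points already constructed. So there are only two realizations, conjugate under \<open>\<surd>2 \<mapsto> -\<surd>2\<close>.\<close>

section \<open>Polynomial functions of three variables\<close>

text \<open>The definitions speak of polynomial functions on C^3, so the unique factorization behind
  Saito's criterion is replaced by arguments on zero sets: a polynomial function that vanishes where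
  a linear form does is a multiple of that form, and a linear factor is cancelled by approaching its
  zeros along a punctured line and using continuity. Homogeneity is likewise handled through the
  scaling law instead of coefficients. Incidences are computed exactly in Z[\<surd>2]. Since a + b
  \<surd>2 vanishes only for a = b = 0, one list of lines settles incidence and non-incidence for
  either square root of 2, over the reals as well as the complex numbers. Rigidity relies on this:
  incidences are read off from the given arrangement, while the root that describes the realization
  is known only at the end of the chain. There 1 + t is that root, because t (2 + t) = 1 means (1 +
  t)^2 = 2.\<close>

lemma sum3_Times:
  fixes g :: "nat \<Rightarrow> nat \<Rightarrow> nat \<Rightarrow> complex"
  shows "(\<Sum>i\<le>k. \<Sum>j\<le>k. \<Sum>l\<le>k. g i j l) = (\<Sum>(i,j,l)\<in>{..k}\<times>{..k}\<times>{..k}. g i j l)"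
  by (simp add: sum.cartesian_product)

text \<open>Supports in arbitrary finite sets, rather than cubes, can be united and extended by one
  monomial at a time, which is what sums and inductions over polynomials need.\<close>

lemma poly3_finite_support:
  assumes "finite I"
  shows "poly3 (\<lambda>(x,y,z). \<Sum>(i,j,l)\<in>I. c i j l * x^i * y^j * z^l)"
proof -
  from assms have "\<exists>k. I \<subseteq> {..k}\<times>{..k}\<times>{..k}"
  proof (induction I rule: finite_induct)
    case (insert t I)
    obtain i j l where t: "t = (i,j,l)" by (cases t)
    from insert obtain k where "I \<subseteq> {..k}\<times>{..k}\<times>{..k}" by blast
    then have "insert t I \<subseteq> {..k+i+j+l}\<times>{..k+i+j+l}\<times>{..k+i+j+l}" 
      by (fastforce simp: t)
    then show ?case by blast
  qed auto
  then obtain k where k: "I \<subseteq> {..k}\<times>{..k}\<times>{..k}" by blast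
  have "(\<lambda>(x,y,z). \<Sum>(i,j,l)\<in>I. c i j l * x^i * y^j * z^l) =
    (\<lambda>(x,y,z). \<Sum>i\<le>k. \<Sum>j\<le>k. \<Sum>l\<le>k. (if (i,j,l) \<in> I then c i j l else 0) * x^i * y^j * z^l)"
    unfolding sum3_Times using k
    by (auto simp: fun_eq_iff intro!: sum.mono_neutral_cong_left)
  then show ?thesis unfolding poly3_def
    by (intro exI[of _ k] exI[of _ "\<lambda>i j l. if (i,j,l) \<in> I then c i j l else 0"])
qed

lemma poly3_monom: "poly3 (\<lambda>(x,y,z). a * x^i * y^j * z^l)"
  using poly3_finite_support[of "{(i,j,l)}" "\<lambda>_ _ _. a"] by simp

lemma poly3_add:
  assumes "poly3 p" "poly3 q"
  shows "poly3 (\<lambda>v. p v + q v)"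
proof -
  obtain k c where p: "p = (\<lambda>(x,y,z). \<Sum>i\<le>k. \<Sum>j\<le>k. \<Sum>l\<le>k. c i j l * x^i * y^j * z^l)"
    using assms(1) unfolding poly3_def by blast
  obtain m d where q: "q = (\<lambda>(x,y,z). \<Sum>i\<le>m. \<Sum>j\<le>m. \<Sum>l\<le>m. d i j l * x^i * y^j * z^l)"
    using assms(2) unfolding poly3_def by blast
  let ?A = "{..k}\<times>{..k}\<times>{..k}" and ?B = "{..m}\<times>{..m}\<times>{..m}"
  have "(\<lambda>v. p v + q v) = (\<lambda>(x,y,z). \<Sum>(i,j,l)\<in>?A \<union> ?B.
     ((if (i,j,l) \<in> ?A then c i j l else 0) + (if (i,j,l) \<in> ?B then d i j l else 0)) * x^i * y^j * z^l)"
  proof (rule ext, clarify)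
    fix x y z
    have 1: "(\<Sum>(i,j,l)\<in>?A. c i j l * x^i * y^j * z^l) =
       (\<Sum>(i,j,l)\<in>?A \<union> ?B. (if (i,j,l) \<in> ?A then c i j l else 0) * x^i * y^j * z^l)"
      by (rule sum.mono_neutral_cong_left) (auto split: if_splits)
    have 2: "(\<Sum>(i,j,l)\<in>?B. d i j l * x^i * y^j * z^l) =
       (\<Sum>(i,j,l)\<in>?A \<union> ?B. (if (i,j,l) \<in> ?B then d i j l else 0) * x^i * y^j * z^l)"
      by (rule sum.mono_neutral_cong_left) (auto split: if_splits)
    show "p (x,y,z) + q (x,y,z) = (\<Sum>(i,j,l)\<in>?A \<union> ?B.
     ((if (i,j,l) \<in> ?A then c i j l else 0) + (if (i,j,l) \<in> ?B then d i j l else 0)) * x^i * y^j * z^l)"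
      unfolding p q prod.case sum3_Times 1 2 sum.distrib[symmetric]
      by (rule sum.cong) (auto simp: algebra_simps)
  qed
  then show ?thesis using poly3_finite_support[of "?A \<union> ?B"] by simp
qed

lemma poly3_const [simp]: "poly3 (\<lambda>_. a)"
  using poly3_monom[of a 0 0 0] by (simp add: case_prod_unfold)

lemma poly3_sum: "(\<And>i. i \<in> I \<Longrightarrow> poly3 (p i)) \<Longrightarrow> poly3 (\<lambda>v. \<Sum>i\<in>I. p i v)"
  by (induction I rule: infinite_finite_induct) (auto intro: poly3_add)

text \<open>Products, substitution, continuity and the expansion \<open>poly3_Hadamard\<close> are
  additive in the polynomial and are reduced to monomials by this rule. Zero needs no case of its
  own: it is the monomial with coefficient 0.\<close>

lemma poly3_induct [consumes 1, case_names monom add]: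
  assumes "poly3 p"
    and mon: "\<And>a i j l. Q (\<lambda>(x,y,z). a * x^i * y^j * z^l)"
    and add: "\<And>p q. poly3 p \<Longrightarrow> poly3 q \<Longrightarrow> Q p \<Longrightarrow> Q q \<Longrightarrow> Q (\<lambda>v. p v + q v)"
  shows "Q p"
proof -
  obtain k c where p: "p = (\<lambda>(x,y,z). \<Sum>i\<le>k. \<Sum>j\<le>k. \<Sum>l\<le>k. c i j l * x^i * y^j * z^l)"
    using assms(1) unfolding poly3_def by blast
  have Q0: "Q (\<lambda>_. 0)" using mon[of 0 0 0 0] by (simp add: case_prod_unfold)
  have "Q (\<lambda>(x,y,z). \<Sum>(i,j,l)\<in>I. c i j l * x^i * y^j * z^l)" if "finite I" for I
    using that
  proof (induction I rule: finite_induct)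
    case empty
    show ?case using Q0 by (simp add: case_prod_unfold)
  next
    case (insert t I)
    obtain i j l where t: "t = (i,j,l)" by (cases t)
    show ?case
      using add[OF poly3_monom poly3_finite_support[OF insert(1)] mon insert(3), of "c i j l" i j l] insert(1,2)
      by (simp add: t case_prod_unfold)
  qed
  from this[of "{..k}\<times>{..k}\<times>{..k}"] show ?thesis unfolding p sum3_Times by simp
qed

lemma poly3_mult:
  assumes "poly3 p" "poly3 q"
  shows "poly3 (\<lambda>v. p v * q v)"
  using assms(1)
proof (induction rule: poly3_induct)
  case (monom a i j l)
  show ?case using assms(2)
  proof (induction rule: poly3_induct)
    case (monom b i' j' l')
    show ?case using poly3_monom[of "a * b" "i + i'" "j + j'" "l + l'"]
      by (simp add: case_prod_unfold power_add algebra_simps)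
  next
    case (add p q)
    show ?case using poly3_add[OF add(3,4)] by (simp add: algebra_simps)
  qed
next
  case (add p q)
  show ?case using poly3_add[OF add(3,4)] by (simp add: algebra_simps)
qed

lemma poly3_coords [simp]:
  "poly3 (\<lambda>v. fst v)" "poly3 (\<lambda>v. fst (snd v))" "poly3 (\<lambda>v. snd (snd v))"
  using poly3_monom[of 1 1 0 0] poly3_monom[of 1 0 1 0] poly3_monom[of 1 0 0 1]
  by (simp_all add: case_prod_unfold)

lemma poly3_minus: "poly3 p \<Longrightarrow> poly3 (\<lambda>v. - p v)"
  using poly3_mult[OF poly3_const[of "-1"]] by simp

lemma poly3_diff: "poly3 p \<Longrightarrow> poly3 q \<Longrightarrow> poly3 (\<lambda>v. p v - q v)"
  using poly3_add[OF _ poly3_minus, of p q] by simp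

lemma poly3_power: "poly3 p \<Longrightarrow> poly3 (\<lambda>v. p v ^ n)"
  by (induction n) (auto intro: poly3_mult)

lemma poly3_prod: "(\<And>i. i \<in> I \<Longrightarrow> poly3 (p i)) \<Longrightarrow> poly3 (\<lambda>v. \<Prod>i\<in>I. p i v)"
  by (induction I rule: infinite_finite_induct) (auto intro: poly3_mult)

lemmas poly3_intros = poly3_const poly3_coords poly3_add poly3_mult poly3_diff poly3_minus poly3_power
  poly3_sum poly3_prod

lemma poly3_compose:
  assumes "poly3 p" "poly3 a" "poly3 b" "poly3 c"
  shows "poly3 (\<lambda>v. p (a v, b v, c v))"
  using assms(1)
proof (induction rule: poly3_induct)
  case (monom k i j l)
  show ?case by (simp, intro poly3_intros assms)
qed (auto intro: poly3_add)

lemma poly3_continuous: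
  assumes "poly3 p"
  shows "continuous_on UNIV p"
  using assms
proof (induction rule: poly3_induct)
  case (monom k i j l)
  show ?case unfolding case_prod_unfold by (intro continuous_intros)
qed (auto intro: continuous_on_add)

text \<open>The density argument behind cancellation: a factor that is nonzero for t \<noteq> 0 can
  be divided out there, and continuity supplies the value at 0.\<close>

lemma zero_at_puncture:
  fixes g :: "complex \<Rightarrow> complex"
  assumes "continuous_on UNIV g" "\<And>t. t \<noteq> 0 \<Longrightarrow> g t = 0"
  shows "g 0 = 0"
proof -
  have "(g \<longlongrightarrow> g 0) (at 0)"
    using assms(1) by (simp add: continuous_on_eq_continuous_at isCont_def)
  moreover have "(g \<longlongrightarrow> 0) (at 0)"
    by (rule Lim_transform_eventually[OF tendsto_const])
      (auto simp: eventually_at_filter assms(2))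
  ultimately show ?thesis using tendsto_unique[OF at_neq_bot] by blast
qed

lemma poly3_restrict_continuous:
  assumes "poly3 p" "continuous_on UNIV a" "continuous_on UNIV b" "continuous_on UNIV c"
  shows "continuous_on UNIV (\<lambda>t::complex. p (a t, b t, c t))"
  by (rule continuous_on_compose2[OF poly3_continuous[OF assms(1)]]) (auto intro!: continuous_intros assms)

section \<open>Linear forms as prime divisors of polynomial functions\<close>

definition lf :: "complex^3 \<Rightarrow> complex \<times> complex \<times> complex \<Rightarrow> complex" where
  "lf u p = (case p of (x,y,z) \<Rightarrow> u$1 * x + u$2 * y + u$3 * z)"

lemma lf_alt: "lf u p = u$1 * fst p + u$2 * fst (snd p) + u$3 * snd (snd p)"
  by (simp add: lf_def case_prod_unfold)

lemma poly3_lf [intro!]: "poly3 (lf u)"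
  unfolding lf_alt[abs_def] by (intro poly3_intros)

lemma lf_scale: "lf u (t * x, t * y, t * z) = t * lf u (x,y,z)"
  by (simp add: lf_def algebra_simps)

lemma vec3_eq_iff: "(u :: 'a^3) = v \<longleftrightarrow> u$1 = v$1 \<and> u$2 = v$2 \<and> u$3 = v$3"
  by (simp add: vec_eq_iff forall_3)

lemma lf_eq_1_ex:
  assumes "u \<noteq> 0"
  obtains a b c where "lf u (a,b,c) = 1"
proof -
  consider "u$1 \<noteq> 0" | "u$2 \<noteq> 0" | "u$3 \<noteq> 0"
    using assms by (auto simp: vec3_eq_iff)
  then show ?thesis
  proof cases
    case 1 then show ?thesis using that[of "1 / u$1" 0 0] by (simp add: lf_def)
  next
    case 2 then show ?thesis using that[of 0 "1 / u$2" 0] by (simp add: lf_def)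
  next
    case 3 then show ?thesis using that[of 0 0 "1 / u$3"] by (simp add: lf_def)
  qed
qed

text \<open>Replacing the coordinates one after the other splits the difference into three, and x^n
  - y^n is divisible by x - y.\<close>

lemma poly3_Hadamard:
  assumes "poly3 p" "poly3 a" "poly3 b" "poly3 c"
  shows "\<exists>q1 q2 q3. poly3 q1 \<and> poly3 q2 \<and> poly3 q3 \<and>
    (\<forall>v. p v - p (a v, b v, c v) =
       (fst v - a v) * q1 v + (fst (snd v) - b v) * q2 v + (snd (snd v) - c v) * q3 v)"
  using assms(1)
proof (induction rule: poly3_induct)
  case (monom k i j l)
  define S where "S = (\<lambda>(n::nat) (x::complex) y. \<Sum>m<n. y ^ (n - Suc m) * x ^ m)"
  have S: "x ^ n - y ^ n = (x - y) * S n x y" for x y n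
    unfolding S_def by (rule power_diff_sumr2)
  have pS: "poly3 (\<lambda>v. S n (f v) (g v))" if "poly3 f" "poly3 g" for f g n
    unfolding S_def by (intro poly3_intros that)
  let ?q1 = "\<lambda>v. k * S i (fst v) (a v) * fst (snd v) ^ j * snd (snd v) ^ l"
  let ?q2 = "\<lambda>v. k * a v ^ i * S j (fst (snd v)) (b v) * snd (snd v) ^ l"
  let ?q3 = "\<lambda>v. k * a v ^ i * b v ^ j * S l (snd (snd v)) (c v)"
  have "poly3 ?q1 \<and> poly3 ?q2 \<and> poly3 ?q3"
    by (intro conjI poly3_intros pS assms)
  moreover have "k * x ^ i * y ^ j * z ^ l - k * a' ^ i * b' ^ j * c' ^ l =
     (x - a') * (k * S i x a' * y ^ j * z ^ l) + (y - b') * (k * a' ^ i * S j y b' * z ^ l)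
     + (z - c') * (k * a' ^ i * b' ^ j * S l z c')" for x y z a' b' c'
  proof -
    have "k * x ^ i * y ^ j * z ^ l - k * a' ^ i * b' ^ j * c' ^ l =
      k * (x ^ i - a' ^ i) * y ^ j * z ^ l + k * a' ^ i * (y ^ j - b' ^ j) * z ^ l +
      k * a' ^ i * b' ^ j * (z ^ l - c' ^ l)" by (simp add: algebra_simps)
    then show ?thesis unfolding S by (simp add: algebra_simps)
  qed
  ultimately show ?case
    by (intro exI[of _ ?q1] exI[of _ ?q2] exI[of _ ?q3]) (simp add: case_prod_unfold)
next
  case (add p q)
  then obtain p1 p2 p3 q1 q2 q3 where
    *: "poly3 p1" "poly3 p2" "poly3 p3" "poly3 q1" "poly3 q2" "poly3 q3" and
    p: "\<And>v. p v - p (a v, b v, c v) =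
       (fst v - a v) * p1 v + (fst (snd v) - b v) * p2 v + (snd (snd v) - c v) * p3 v" and
    q: "\<And>v. q v - q (a v, b v, c v) =
       (fst v - a v) * q1 v + (fst (snd v) - b v) * q2 v + (snd (snd v) - c v) * q3 v"
    by metis
  have "p v + q v - (p (a v, b v, c v) + q (a v, b v, c v)) =
    (fst v - a v) * (p1 v + q1 v) + (fst (snd v) - b v) * (p2 v + q2 v) + (snd (snd v) - c v) * (p3 v + q3 v)" for v
  proof -
    have "p v + q v - (p (a v, b v, c v) + q (a v, b v, c v)) =
      (p v - p (a v, b v, c v)) + (q v - q (a v, b v, c v))" by simp
    then show ?thesis unfolding p q by (simp add: algebra_simps)
  qed
  then show ?case
    by (intro exI[of _ "\<lambda>v. p1 v + q1 v"] exI[of _ "\<lambda>v. p2 v + q2 v"] exI[of _ "\<lambda>v. p3 v + q3 v"])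
      (simp add: poly3_add *)
qed

text \<open>A point w with \<open>lf u w = 1\<close> gives the projection v - \<open>lf u v\<close>
  w onto the plane of \<open>u\<close>. There \<open>p\<close> vanishes, and each coordinate of v
  minus its projection is a multiple of \<open>lf u v\<close>, so the expansion of
  \<open>poly3_Hadamard\<close> exhibits the quotient.\<close>

lemma lf_dvd:
  assumes "poly3 p" "u \<noteq> 0" "\<And>v. lf u v = 0 \<Longrightarrow> p v = 0"
  shows "\<exists>q. poly3 q \<and> (\<forall>v. p v = lf u v * q v)"
proof -
  obtain a b c where w: "lf u (a,b,c) = 1" using lf_eq_1_ex[OF assms(2)] .
  let ?a = "\<lambda>v. fst v - lf u v * a" and ?b = "\<lambda>v. fst (snd v) - lf u v * b"
    and ?c = "\<lambda>v. snd (snd v) - lf u v * c"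
  have "poly3 ?a" "poly3 ?b" "poly3 ?c" by (intro poly3_intros poly3_lf)+
  from poly3_Hadamard[OF assms(1) this] obtain q1 q2 q3 where
    q: "poly3 q1" "poly3 q2" "poly3 q3" and
    eq: "\<And>v. p v - p (?a v, ?b v, ?c v) =
       (fst v - ?a v) * q1 v + (fst (snd v) - ?b v) * q2 v + (snd (snd v) - ?c v) * q3 v"
    by blast
  have "lf u (?a v, ?b v, ?c v) = lf u v - lf u v * lf u (a,b,c)" for v
    by (simp add: lf_alt algebra_simps)
  then have "p (?a v, ?b v, ?c v) = 0" for v
    using assms(3) w by simp
  then have "p v = lf u v * (a * q1 v + b * q2 v + c * q3 v)" for v
    using eq[of v] by (simp add: algebra_simps)
  then show ?thesis
    by (intro exI[of _ "\<lambda>v. a * q1 v + b * q2 v + c * q3 v"]) (auto intro!: poly3_intros q)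
qed

text \<open>If \<open>u'\<close> vanished on the whole plane of \<open>u\<close>, projecting along w
  with \<open>lf u w = 1\<close> would give \<open>u'\<close> as \<open>lf u' w\<close> times
  \<open>u\<close>. The case \<open>u = 0\<close> is included on purpose: it covers cancellation on
  the whole space.\<close>

lemma lf_separate:
  assumes "\<nexists>c. u' = c *s u"
  obtains x y z where "lf u (x,y,z) = 0" "lf u' (x,y,z) \<noteq> 0"
proof (cases "u = 0")
  case True
  have "u' \<noteq> 0"
  proof
    assume "u' = 0"
    then have "u' = 0 *s u" by (simp add: vec_eq_iff)
    then show False using assms by blast
  qed
  then obtain x y z where "lf u' (x,y,z) = 1" by (rule lf_eq_1_ex)
  moreover have "lf u (x,y,z) = 0" by (simp add: True lf_def)
  ultimately show ?thesis using that[of x y z] by simp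
next
  case False
  obtain a b c where w: "lf u (a,b,c) = 1" using lf_eq_1_ex[OF False] .
  show ?thesis
  proof (rule ccontr)
    assume "\<not> thesis"
    with that have z: "\<And>x y z. lf u (x,y,z) = 0 \<Longrightarrow> lf u' (x,y,z) = 0" by blast
    define k where "k = lf u' (a,b,c)"
    have "lf u' (x,y,z) = k * lf u (x,y,z)" for x y z
    proof -
      let ?t = "lf u (x,y,z)"
      have "lf u (x - ?t * a, y - ?t * b, z - ?t * c) = ?t - ?t * lf u (a,b,c)"
        by (simp add: lf_alt algebra_simps)
      then have "lf u' (x - ?t * a, y - ?t * b, z - ?t * c) = 0" using z w by simp
      then show ?thesis by (simp add: k_def lf_def algebra_simps)
    qed
    from this[of 1 0 0] this[of 0 1 0] this[of 0 0 1]
    have "u' = k *s u" by (simp add: lf_def vec3_eq_iff)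
    then show False using assms by blast
  qed
qed

text \<open>At a common zero of both forms, move inside the plane of \<open>u\<close> in a direction
  where \<open>u'\<close> does not vanish. Off the starting point \<open>q\<close> is zero by
  hypothesis, and at the starting point by continuity.\<close>

lemma lf_prime:
  assumes "\<nexists>c. u' = c *s u" "poly3 q" "\<And>v. lf u v = 0 \<Longrightarrow> lf u' v * q v = 0" "lf u v = 0"
  shows "q v = 0"
proof -
  obtain a b c where w: "lf u (a,b,c) = 0" "lf u' (a,b,c) \<noteq> 0" using lf_separate[OF assms(1)] .
  obtain x y z where v: "v = (x,y,z)" by (cases v)
  show ?thesis
  proof (cases "lf u' v = 0")
    case True
    let ?v = "\<lambda>t. (x + t * a, y + t * b, z + t * c)"
    have "continuous_on UNIV (\<lambda>t. q (?v t))"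
      by (rule poly3_restrict_continuous[OF assms(2)]) (intro continuous_intros)+
    moreover have "q (?v t) = 0" if "t \<noteq> 0" for t
    proof -
      have "lf u (?v t) = lf u v + t * lf u (a,b,c)" "lf u' (?v t) = lf u' v + t * lf u' (a,b,c)"
        by (simp_all add: lf_def v algebra_simps)
      then have "lf u (?v t) = 0" "lf u' (?v t) \<noteq> 0" using w True assms(4) that by simp_all
      then show ?thesis using assms(3)[of "?v t"] by simp
    qed
    ultimately have "q (?v 0) = 0" by (rule zero_at_puncture)
    then show ?thesis by (simp add: v)
  qed (use assms(3)[OF assms(4)] in simp)
qed

lemma lf_prod_prime:
  assumes "finite I" "\<And>i. i \<in> I \<Longrightarrow> \<nexists>c. U i = c *s u" "poly3 q"
    "\<And>v. lf u v = 0 \<Longrightarrow> (\<Prod>i\<in>I. lf (U i) v) * q v = 0" "lf u v = 0"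
  shows "q v = 0"
  using assms
proof (induction I arbitrary: v rule: finite_induct)
  case (insert i I)
  have "poly3 (\<lambda>v. (\<Prod>i\<in>I. lf (U i) v) * q v)"
    by (intro poly3_intros poly3_lf insert.prems)
  then have *: "(\<Prod>i\<in>I. lf (U i) v) * q v = 0" if "lf u v = 0" for v
  proof (rule lf_prime[where u' = "U i" and u = u, rotated])
    show "\<nexists>c. U i = c *s u" by (rule insert.prems(1)) simp
    show "lf (U i) v * ((\<Prod>i\<in>I. lf (U i) v) * q v) = 0" if "lf u v = 0" for v
      using insert.prems(3)[OF that] insert.hyps by (simp add: mult.assoc)
  qed (rule that)
  show ?case
    by (rule insert.IH[OF _ insert.prems(2) * insert.prems(4)]) (rule insert.prems(1), rule insertI2)
qed simp

text \<open>The case \<open>u = 0\<close> of \<open>lf_prod_prime\<close>: the plane of the zero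
  form is everything, and not being a multiple of 0 means being nonzero.\<close>

lemma lf_prod_cancel:
  assumes "finite I" "\<And>i. i \<in> I \<Longrightarrow> U i \<noteq> 0" "poly3 q" "\<And>v. (\<Prod>i\<in>I. lf (U i) v) * q v = 0"
  shows "q v = 0"
  using lf_prod_prime[of I U 0 q v] assms by (simp add: lf_def)

text \<open>The forms are divided out one at a time; by primeness the quotient still vanishes on the
  plane of the next form, which is proportional to none of the previous ones.\<close>

lemma lf_prod_dvd:
  assumes "finite I" "poly3 p" "\<And>i. i \<in> I \<Longrightarrow> U i \<noteq> 0"
    "\<And>i j. i \<in> I \<Longrightarrow> j \<in> I \<Longrightarrow> i \<noteq> j \<Longrightarrow> \<nexists>c. U i = c *s U j"
    "\<And>i v. i \<in> I \<Longrightarrow> lf (U i) v = 0 \<Longrightarrow> p v = 0"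
  shows "\<exists>q. poly3 q \<and> (\<forall>v. p v = (\<Prod>i\<in>I. lf (U i) v) * q v)"
  using assms
proof (induction I rule: finite_induct)
  case empty
  then show ?case by (intro exI[of _ p]) simp
next
  case (insert i I)
  then obtain q where q: "poly3 q" "\<And>v. p v = (\<Prod>i\<in>I. lf (U i) v) * q v" by (metis insertCI)
  have "q v = 0" if "lf (U i) v = 0" for v
  proof (rule lf_prod_prime[OF insert.hyps(1) _ q(1) _ that])
    show "\<nexists>c. U j = c *s U i" if "j \<in> I" for j
      using insert.prems(3)[of j i] insert.hyps that by auto
    show "(\<Prod>i\<in>I. lf (U i) v) * q v = 0" if "lf (U i) v = 0" for v
      using insert.prems(4)[of i v] that q(2)[of v] by simp
  qed
  then obtain r where "poly3 r" "\<And>v. q v = lf (U i) v * r v"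
    using lf_dvd[OF q(1)] insert.prems(2) by blast
  then show ?case using q(2) insert.hyps by (intro exI[of _ r]) (simp add: mult_ac)
qed

section \<open>Homogeneous polynomial functions\<close>

lemma hpoly3_poly3:
  assumes "hpoly3 d p"
  shows "poly3 p"
proof -
  obtain c where "p = (\<lambda>(x,y,z). \<Sum>i\<le>d. \<Sum>j\<le>d. \<Sum>l\<le>d. if i + j + l = d then c i j l * x^i * y^j * z^l else 0)"
    using assms unfolding hpoly3_def by blast
  then have "p = (\<lambda>(x,y,z). \<Sum>i\<le>d. \<Sum>j\<le>d. \<Sum>l\<le>d. (if i + j + l = d then c i j l else 0) * x^i * y^j * z^l)"
    by (auto simp: fun_eq_iff intro!: sum.cong)
  then show ?thesis unfolding poly3_def
    by (intro exI[of _ d] exI[of _ "\<lambda>i j l. if i + j + l = d then c i j l else 0"])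
qed

lemma hpoly3_scale:
  assumes "hpoly3 d p"
  shows "p (t * x, t * y, t * z) = t ^ d * p (x,y,z)"
proof -
  obtain c where p: "p = (\<lambda>(x,y,z). \<Sum>i\<le>d. \<Sum>j\<le>d. \<Sum>l\<le>d. if i + j + l = d then c i j l * x^i * y^j * z^l else 0)"
    using assms unfolding hpoly3_def by blast
  show ?thesis unfolding p prod.case sum_distrib_left
    by (intro sum.cong refl) (auto simp: power_mult_distrib power_add)
qed

text \<open>Along the ray through (x,y,z) the part of total degree m becomes the coefficient of t^m,
  so the scaling law leaves only the part of degree d.\<close>

lemma hpoly3I:
  assumes "poly3 p" and hom: "\<And>t x y z. t \<noteq> 0 \<Longrightarrow> p (t * x, t * y, t * z) = t ^ d * p (x,y,z)"
  shows "hpoly3 d p"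
proof -
  obtain k c where p: "p = (\<lambda>(x,y,z). \<Sum>i\<le>k. \<Sum>j\<le>k. \<Sum>l\<le>k. c i j l * x^i * y^j * z^l)"
    using assms(1) unfolding poly3_def by blast
  let ?I = "{..k}\<times>{..k}\<times>{..k}"
  \<comment> \<open>The comparison of coefficients below is made for all t, so the value at t = 0 is
    added by continuity.\<close>
  have hom': "p (t * x, t * y, t * z) = t ^ d * p (x,y,z)" for t x y z
  proof (cases "t = 0")
    case True
    have "continuous_on UNIV (\<lambda>t. p (t * x, t * y, t * z) - t ^ d * p (x,y,z))"
      
      by (rule continuous_on_diff, rule poly3_restrict_continuous[OF assms(1)]) (intro continuous_intros)+
    from zero_at_puncture[OF this] show ?thesis using hom True by simp
  qed (use hom in auto)
  have "p (x,y,z) = (\<Sum>i\<le>d. \<Sum>j\<le>d. \<Sum>l\<le>d. if i + j + l = d then (if (i,j,l) \<in> ?I then c i j l else 0) * x^i * y^j * z^l else 0)" for x y z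
  proof -
    \<comment> \<open>This bounds both d and every total degree that occurs, which is at most 3
      k.\<close>
    define n where "n = 3 * k + d"
    define h where "h m = (\<Sum>(i,j,l)\<in>{(i,j,l)\<in>?I. i + j + l = m}. c i j l * x^i * y^j * z^l)" for m
    have "(\<Sum>m\<le>n. h m * t ^ m) = (\<Sum>m\<le>n. (if m = d then p (x,y,z) else 0) * t ^ m)" for t
    proof -
      have "(\<Sum>m\<le>n. h m * t ^ m) =
         (\<Sum>m\<le>n. \<Sum>v\<in>{v\<in>?I. (case v of (i,j,l) \<Rightarrow> i + j + l) = m}. (case v of (i,j,l) \<Rightarrow> c i j l * (t*x)^i * (t*y)^j * (t*z)^l))"
        unfolding h_def sum_distrib_right
        by (intro sum.cong) (auto simp: power_mult_distrib power_add)
      also have "\<dots> = (\<Sum>v\<in>?I. (case v of (i,j,l) \<Rightarrow> c i j l * (t*x)^i * (t*y)^j * (t*z)^l))"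
        by (rule sum.group) (auto simp: n_def)
      also have "\<dots> = p (t * x, t * y, t * z)" by (simp add: p sum3_Times)
      also have "\<dots> = (\<Sum>m\<le>n. (if m = d then p (x,y,z) else 0) * t ^ m)"
        unfolding hom' by (subst sum.remove[of _ d]) (auto simp: n_def)
      finally show ?thesis .
    qed
    then have "\<forall>m\<le>n. h m = (if m = d then p (x,y,z) else 0)"
      using polyfun_eq_coeffs[of h n "\<lambda>m. if m = d then p (x,y,z) else 0"] by blast
    then have "p (x,y,z) = h d" by (simp add: n_def)
    also have "\<dots> = (\<Sum>i\<le>d. \<Sum>j\<le>d. \<Sum>l\<le>d. if i + j + l = d then (if (i,j,l) \<in> ?I then c i j l else 0) * x^i * y^j * z^l else 0)"
      unfolding h_def sum3_Times
      by (rule sum.mono_neutral_cong_left) (auto split: if_splits)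
    finally show ?thesis .
  qed
  then show ?thesis unfolding hpoly3_def
    by (intro exI[of _ "\<lambda>i j l. if (i,j,l) \<in> ?I then c i j l else 0"]) (simp add: fun_eq_iff)
qed

text \<open>For t \<noteq> 0 the products of \<open>lf u v\<close> with q(t v) and with t^d q(v)
  agree, and the form can be cancelled from the difference.\<close>

lemma hpoly3_lf_quotient:
  assumes "hpoly3 (Suc d) (\<lambda>v. lf u v * q v)" "poly3 q" "u \<noteq> 0"
  shows "hpoly3 d q"
proof (rule hpoly3I[OF assms(2)])
  fix t x y z :: complex
  assume t: "t \<noteq> 0"
  let ?r = "\<lambda>v. q (t * fst v, t * fst (snd v), t * snd (snd v)) - t ^ d * q v"
  have r: "poly3 ?r"
    by (intro poly3_diff poly3_mult poly3_const assms(2) poly3_compose[OF assms(2)] poly3_coords)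
  have "(\<Prod>i\<in>{()}. lf u v) * ?r v = 0" for v
    using hpoly3_scale[OF assms(1), of t "fst v" "fst (snd v)" "snd (snd v)"] t
    by (simp add: lf_scale algebra_simps)
  from lf_prod_cancel[of "{()}" "\<lambda>_. u", OF _ _ r this, of "(x,y,z)"] assms(3)
  show "q (t * x, t * y, t * z) = t ^ d * q (x,y,z)" by simp
qed

section \<open>Saito's criterion for arrangements containing the line at infinity\<close>

lemma arr_poly_lf: "arr_poly n L v = (\<Prod>i<n. lf (L i) v)"
  by (simp add: arr_poly_def lf_def case_prod_unfold)

lemma arr_poly_derivs:
  "dx (arr_poly n L) v = (\<Sum>i<n. L i $ 1 * (\<Prod>j\<in>{..<n}-{i}. lf (L j) v))"
  "dy (arr_poly n L) v = (\<Sum>i<n. L i $ 2 * (\<Prod>j\<in>{..<n}-{i}. lf (L j) v))"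
  "dz (arr_poly n L) v = (\<Sum>i<n. L i $ 3 * (\<Prod>j\<in>{..<n}-{i}. lf (L j) v))"
proof -
  obtain x y z where v: "v = (x,y,z)" by (cases v)
  have "((\<lambda>t. \<Prod>i<n. lf (L i) (t,y,z)) has_field_derivative
      (\<Sum>i<n. L i $ 1 * (\<Prod>j\<in>{..<n}-{i}. lf (L j) v))) (at x)"
    unfolding v by (rule has_field_derivative_prod) (auto simp: lf_def intro!: derivative_eq_intros)
  then show "dx (arr_poly n L) v = (\<Sum>i<n. L i $ 1 * (\<Prod>j\<in>{..<n}-{i}. lf (L j) v))"
    by (simp add: dx_def v arr_poly_lf DERIV_imp_deriv)
  have "((\<lambda>t. \<Prod>i<n. lf (L i) (x,t,z)) has_field_derivative
      (\<Sum>i<n. L i $ 2 * (\<Prod>j\<in>{..<n}-{i}. lf (L j) v))) (at y)"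
    unfolding v by (rule has_field_derivative_prod) (auto simp: lf_def intro!: derivative_eq_intros)
  then show "dy (arr_poly n L) v = (\<Sum>i<n. L i $ 2 * (\<Prod>j\<in>{..<n}-{i}. lf (L j) v))"
    by (simp add: dy_def v arr_poly_lf DERIV_imp_deriv)
  have "((\<lambda>t. \<Prod>i<n. lf (L i) (x,y,t)) has_field_derivative
      (\<Sum>i<n. L i $ 3 * (\<Prod>j\<in>{..<n}-{i}. lf (L j) v))) (at z)"
    unfolding v by (rule has_field_derivative_prod) (auto simp: lf_def intro!: derivative_eq_intros)
  then show "dz (arr_poly n L) v = (\<Sum>i<n. L i $ 3 * (\<Prod>j\<in>{..<n}-{i}. lf (L j) v))"
    by (simp add: dz_def v arr_poly_lf DERIV_imp_deriv)
qed

text \<open>Leibniz' rule with the lines as factors: a derivation with components a, b, c sends the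
  form of a line to its value at (a,b,c).\<close>

lemma arr_poly_derivation:
  "a * dx (arr_poly n L) v + b * dy (arr_poly n L) v + c * dz (arr_poly n L) v =
     (\<Sum>i<n. lf (L i) (a,b,c) * (\<Prod>j\<in>{..<n}-{i}. lf (L j) v))"
  unfolding arr_poly_derivs sum_distrib_left sum.distrib[symmetric]
  by (rule sum.cong) (simp_all add: lf_def algebra_simps)

lemma arr_poly_Euler:
  "fst v * dx (arr_poly n L) v + fst (snd v) * dy (arr_poly n L) v + snd (snd v) * dz (arr_poly n L) v =
     of_nat n * arr_poly n L v"
proof -
  have "lf (L i) v * (\<Prod>j\<in>{..<n}-{i}. lf (L j) v) = arr_poly n L v" if "i < n" for i
    unfolding arr_poly_lf by (rule prod.remove[symmetric]) (use that in auto)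
  then show ?thesis unfolding arr_poly_derivation by simp
qed

text \<open>On line i all summands of the Leibniz expansion except the i-th contain the form of line
  i. The remaining summand vanishes there, and its product of the other forms is cancelled by
  primeness.\<close>

lemma syz_tangent:
  assumes "line_arr n L" "syz (arr_poly n L) (a,b,c)" "i < n" "lf (L i) v = 0"
  shows "lf (L i) (a v, b v, c v) = 0"
proof -
  have p: "poly3 a" "poly3 b" "poly3 c" and
    s: "\<And>v. a v * dx (arr_poly n L) v + b v * dy (arr_poly n L) v + c v * dz (arr_poly n L) v = 0"
    using assms(2) by (auto simp: syz_def)
  show ?thesis
  proof (rule lf_prod_prime[where I = "{..<n}-{i}" and U = L and u = "L i" and q = "\<lambda>v. lf (L i) (a v, b v, c v)"])
    show "\<nexists>k. L j = k *s L i" if "j \<in> {..<n}-{i}" for j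
      using assms(1,3) that by (auto simp: line_arr_def)
    show "poly3 (\<lambda>v. lf (L i) (a v, b v, c v))" by (rule poly3_compose[OF poly3_lf p])
    fix v assume v: "lf (L i) v = 0"
    have "(\<Sum>j<n. lf (L j) (a v, b v, c v) * (\<Prod>k\<in>{..<n}-{j}. lf (L k) v)) =
       lf (L i) (a v, b v, c v) * (\<Prod>k\<in>{..<n}-{i}. lf (L k) v) +
       (\<Sum>j\<in>{..<n}-{i}. lf (L j) (a v, b v, c v) * (\<Prod>k\<in>{..<n}-{j}. lf (L k) v))"
      using assms(3) by (intro sum.remove) auto
    also have "(\<Sum>j\<in>{..<n}-{i}. lf (L j) (a v, b v, c v) * (\<Prod>k\<in>{..<n}-{j}. lf (L k) v)) = 0"
      using assms(3) v by (intro sum.neutral ballI) (auto intro!: prod_zero)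
    finally show "(\<Prod>j\<in>{..<n}-{i}. lf (L j) v) * lf (L i) (a v, b v, c v) = 0"
      using s[of v] by (simp add: arr_poly_derivation mult.commute)
  qed (use assms in auto)
qed

text \<open>Tangency means that the form of each line divides its own derivative. The multiplier of
  the whole product is the sum of these quotients, of degree one less than the field.\<close>

lemma tangent_derivation_multiple:
  assumes L: "line_arr n L" and h: "hpoly3 (Suc d) a" "hpoly3 (Suc d) b" "hpoly3 (Suc d) c"
    and tan: "\<And>i v. i < n \<Longrightarrow> lf (L i) v = 0 \<Longrightarrow> lf (L i) (a v, b v, c v) = 0"
  shows "\<exists>h. hpoly3 d h \<and> (\<forall>v. a v * dx (arr_poly n L) v + b v * dy (arr_poly n L) v + c v * dz (arr_poly n L) v =
     h v * arr_poly n L v)"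
proof -
  note p = h[THEN hpoly3_poly3]
  have "\<exists>k. hpoly3 d k \<and> (\<forall>v. lf (L i) (a v, b v, c v) = lf (L i) v * k v)" if "i < n" for i
  proof -
    have nz: "L i \<noteq> 0" using L that by (auto simp: line_arr_def)
    have p': "poly3 (\<lambda>v. lf (L i) (a v, b v, c v))" by (rule poly3_compose[OF poly3_lf p])
    have h': "hpoly3 (Suc d) (\<lambda>v. lf (L i) (a v, b v, c v))"
      by (rule hpoly3I[OF p']) (simp only: hpoly3_scale[OF h(1)] hpoly3_scale[OF h(2)] hpoly3_scale[OF h(3)] lf_scale)
    have "\<exists>k. poly3 k \<and> (\<forall>v. lf (L i) (a v, b v, c v) = lf (L i) v * k v)"
      by (rule lf_dvd[OF p' nz]) (rule tan[OF that])
    then obtain k where k: "poly3 k" "\<And>v. lf (L i) (a v, b v, c v) = lf (L i) v * k v" by blast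
    then have "hpoly3 d k" using h' nz by (intro hpoly3_lf_quotient[of d "L i" k]) simp_all
    then show ?thesis using k by blast
  qed
  then obtain k where k: "\<And>i. i < n \<Longrightarrow> hpoly3 d (k i)"
    and eq: "\<And>i v. i < n \<Longrightarrow> lf (L i) (a v, b v, c v) = lf (L i) v * k i v" by metis
  let ?h = "\<lambda>v. \<Sum>i<n. k i v"
  have "hpoly3 d ?h"
  proof (rule hpoly3I)
    show "poly3 ?h" by (intro poly3_sum hpoly3_poly3[OF k]) simp
    show "?h (t * x, t * y, t * z) = t ^ d * ?h (x,y,z)" for t x y z
      unfolding sum_distrib_left by (intro sum.cong refl hpoly3_scale k) simp
  qed
  moreover have "(\<Sum>i<n. lf (L i) (a v, b v, c v) * (\<Prod>j\<in>{..<n}-{i}. lf (L j) v)) = ?h v * arr_poly n L v" for v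
    unfolding sum_distrib_right
  proof (rule sum.cong[OF refl])
    fix i assume "i \<in> {..<n}"
    then show "lf (L i) (a v, b v, c v) * (\<Prod>j\<in>{..<n}-{i}. lf (L j) v) = k i v * arr_poly n L v"
      by (simp add: eq arr_poly_lf prod.remove[of _ i])
  qed
  ultimately show ?thesis unfolding arr_poly_derivation by (intro exI[of _ ?h]) simp
qed

lemma hpoly3_mult: "hpoly3 d p \<Longrightarrow> hpoly3 e q \<Longrightarrow> hpoly3 (d + e) (\<lambda>v. p v * q v)"
  by (intro hpoly3I poly3_mult) (auto dest: hpoly3_poly3 simp: hpoly3_scale power_add)

lemma hpoly3_diff: "hpoly3 d p \<Longrightarrow> hpoly3 d q \<Longrightarrow> hpoly3 d (\<lambda>v. p v - q v)"
  by (intro hpoly3I poly3_diff) (auto dest: hpoly3_poly3 simp: hpoly3_scale right_diff_distrib)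

lemma hpoly3_const: "hpoly3 0 (\<lambda>_. a)"
  by (rule hpoly3I) auto

lemma hpoly3_zero: "hpoly3 d (\<lambda>_. 0)"
  by (rule hpoly3I) auto

lemma hpoly3_coords: "hpoly3 1 (\<lambda>v. fst v)" "hpoly3 1 (\<lambda>v. fst (snd v))" "hpoly3 1 (\<lambda>v. snd (snd v))"
  by (auto intro!: hpoly3I)

lemma hpoly3_prod_lf_quotient:
  assumes "finite I" "hpoly3 (card I + d) (\<lambda>v. (\<Prod>i\<in>I. lf (U i) v) * q v)" "poly3 q"
    "\<And>i. i \<in> I \<Longrightarrow> U i \<noteq> 0"
  shows "hpoly3 d q"
  using assms
proof (induction I rule: finite_induct)
  case (insert i I)
  have "hpoly3 (card I + d) (\<lambda>v. (\<Prod>i\<in>I. lf (U i) v) * q v)"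
  proof (rule hpoly3_lf_quotient[of _ "U i"])
    show "hpoly3 (Suc (card I + d)) (\<lambda>v. lf (U i) v * ((\<Prod>i\<in>I. lf (U i) v) * q v))"
      using insert.prems(1) insert.hyps by (simp add: mult.assoc)
    show "poly3 (\<lambda>v. (\<Prod>i\<in>I. lf (U i) v) * q v)"
      by (intro poly3_mult poly3_prod poly3_lf insert.prems)
    show "U i \<noteq> 0" by (rule insert.prems(3)) simp
  qed
  from insert.IH[OF this insert.prems(2)] show ?case using insert.prems(3) by blast
qed simp

lemma hpoly3_0_const:
  assumes "hpoly3 0 q"
  shows "q v = q w"
proof -
  have "q u = q (0,0,0)" for u
    using hpoly3_scale[OF assms, of 0 "fst u" "fst (snd u)" "snd (snd u)"] by simp
  then show ?thesis by metis
qed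

text \<open>Fields without third component are tangent to \<open>L e\<close> for free, as its form
  is a multiple of z. The point \<open>w\<close> certifies that the determinant is not identically
  zero, and positive degrees leave room for the Euler correction, whose multipliers have degrees
  \<open>d1 - 1\<close> and \<open>d2 - 1\<close>.\<close>

theorem Saito_criterion:
  fixes L :: "nat \<Rightarrow> complex^3"
  assumes L: "line_arr n L"
    and e: "e < n" "L e $ 1 = 0" "L e $ 2 = 0"
    and d: "0 < d1" "d1 \<le> d2" "Suc (d1 + d2) = n"
    and h: "hpoly3 d1 a1" "hpoly3 d1 b1" "hpoly3 d2 a2" "hpoly3 d2 b2"
    and tan1: "\<And>i v. i < n \<Longrightarrow> lf (L i) v = 0 \<Longrightarrow> L i $ 1 * a1 v + L i $ 2 * b1 v = 0"
    and tan2: "\<And>i v. i < n \<Longrightarrow> lf (L i) v = 0 \<Longrightarrow> L i $ 1 * a2 v + L i $ 2 * b2 v = 0"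
    and w: "a1 w * b2 w \<noteq> a2 w * b1 w"
  shows "free_curve (arr_poly n L) d1 d2"
proof -
  let ?f = "arr_poly n L"
  let ?x = "\<lambda>v :: complex \<times> complex \<times> complex. fst v" and ?y = "\<lambda>v :: complex \<times> complex \<times> complex. fst (snd v)"
    and ?z = "\<lambda>v :: complex \<times> complex \<times> complex. snd (snd v)"
  define I where "I = {..<n} - {e}"
  define Q where "Q v = (\<Prod>i\<in>I. lf (L i) v)" for v
  have I: "finite I" "card I = d1 + d2" using e(1) d(3) by (auto simp: I_def)
  have nz: "L i \<noteq> 0" if "i < n" for i using L that by (auto simp: line_arr_def)
  have indep: "\<nexists>c. L i = c *s L j" if "i < n" "j < n" "i \<noteq> j" for i j
    using L that by (auto simp: line_arr_def)
  have e3: "L e $ 3 \<noteq> 0" using nz[OF e(1)] e by (auto simp: vec3_eq_iff)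
  have I12: "L i $ 1 \<noteq> 0 \<or> L i $ 2 \<noteq> 0" if "i \<in> I" for i
  proof (rule ccontr)
    assume "\<not> ?thesis"
    then have "L i = (L i $ 3 / L e $ 3) *s L e" using e e3 by (simp add: vec3_eq_iff)
    then have "\<exists>c. L i = c *s L e" by blast
    moreover have "i < n" "i \<noteq> e" using that by (simp_all add: I_def)
    ultimately show False using indep[OF _ e(1)] by blast
  qed
  note p = h[THEN hpoly3_poly3]
  \<comment> \<open>On an affine line both fields are annihilated by the same nonzero covector, so
    their determinant vanishes there.\<close>
  have Q_dvd: "\<exists>q. poly3 q \<and> (\<forall>v. a v * b' v - a' v * b v = Q v * q v)"
    if "poly3 a" "poly3 b" "poly3 a'" "poly3 b'"
      and t: "\<And>i v. i < n \<Longrightarrow> lf (L i) v = 0 \<Longrightarrow> L i $ 1 * a v + L i $ 2 * b v = 0"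
        "\<And>i v. i < n \<Longrightarrow> lf (L i) v = 0 \<Longrightarrow> L i $ 1 * a' v + L i $ 2 * b' v = 0" for a b a' b'
    unfolding Q_def
  proof (rule lf_prod_dvd[OF I(1)])
    show "poly3 (\<lambda>v. a v * b' v - a' v * b v)" by (intro poly3_intros that)
    show "a v * b' v - a' v * b v = 0" if i: "i \<in> I" and v: "lf (L i) v = 0" for i v
    proof -
      have 1: "L i $ 1 * a v + L i $ 2 * b v = 0" "L i $ 1 * a' v + L i $ 2 * b' v = 0"
        using t i v by (auto simp: I_def)
      have "L i $ 1 * (a v * b' v - a' v * b v) = 0" "L i $ 2 * (a v * b' v - a' v * b v) = 0"
        using 1 by algebra+
      then show ?thesis using I12[OF i] by auto
    qed
  qed (use nz indep in \<open>auto simp: I_def\<close>)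
  have Q_cancel: "p v = q v" if "poly3 p" "poly3 q" "\<And>v. Q v * p v = Q v * q v" for p q v
  proof -
    have "p v - q v = 0"
      by (rule lf_prod_cancel[of I L "\<lambda>v. p v - q v"])
        (use I nz that in \<open>auto simp: I_def Q_def right_diff_distrib intro: poly3_diff\<close>)
    then show ?thesis by simp
  qed
  have z_cancel: "p v = q v" if "poly3 p" "poly3 q" "\<And>v. ?z v * p v = ?z v * q v" for p q v
  proof -
    have "p v - q v = 0"
    proof (rule lf_prod_cancel[of "{e}" L "\<lambda>v. p v - q v"])
      show "(\<Prod>i\<in>{e}. lf (L i) v) * (p v - q v) = 0" for v
        using that(3)[of v] by (auto simp: lf_alt e right_diff_distrib)
    qed (use nz e that in \<open>auto intro: poly3_diff\<close>)
    then show ?thesis by simp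
  qed
  obtain q where q: "poly3 q" "\<And>v. a1 v * b2 v - a2 v * b1 v = Q v * q v"
    using Q_dvd[OF p(1,2,3,4) tan1 tan2] by blast
  have "hpoly3 (card I + 0) (\<lambda>v. Q v * q v)"
    using hpoly3_diff[OF hpoly3_mult[OF h(1,4)], of "\<lambda>v. a2 v * b1 v"] hpoly3_mult[OF h(3,2)] I(2)
    by (simp add: q(2) add.commute)
  then have "hpoly3 0 q"
    unfolding Q_def using I nz q(1) by (intro hpoly3_prod_lf_quotient[of I 0 L q]) (auto simp: I_def)
  define \<kappa> where "\<kappa> = q w"
  have det: "a1 v * b2 v - a2 v * b1 v = Q v * \<kappa>" for v
    unfolding q(2) \<kappa>_def using hpoly3_0_const[OF \<open>hpoly3 0 q\<close>, of v w] by simp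
  have \<kappa>: "\<kappa> \<noteq> 0" using det[of w] w by auto
  have n0: "of_nat n \<noteq> (0::complex)" using d by simp
  obtain e1 where e1: "d1 = Suc e1" using d(1) by (cases d1) auto
  obtain e2 where e2: "d2 = Suc e2" using d(1,2) by (cases d2) auto
  obtain h1 where h1: "hpoly3 e1 h1" "\<And>v. a1 v * dx ?f v + b1 v * dy ?f v = h1 v * ?f v"
    using tangent_derivation_multiple[OF L, of e1 a1 b1 "\<lambda>_. 0"] h hpoly3_zero tan1
    by (auto simp: e1 lf_def)
  obtain h2 where h2: "hpoly3 e2 h2" "\<And>v. a2 v * dx ?f v + b2 v * dy ?f v = h2 v * ?f v"
    using tangent_derivation_multiple[OF L, of e2 a2 b2 "\<lambda>_. 0"] h hpoly3_zero tan2
    by (auto simp: e2 lf_def)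
  note ph = h1(1)[THEN hpoly3_poly3] h2(1)[THEN hpoly3_poly3]
  \<comment> \<open>Subtracting a multiple of the Euler field turns a field tangent to all lines into a syzygy.\<close>
  define k1 where "k1 v = h1 v / of_nat n" for v
  define k2 where "k2 v = h2 v / of_nat n" for v
  have hk: "hpoly3 e1 k1" "hpoly3 e2 k2"
    using hpoly3_mult[OF hpoly3_const[of "1 / of_nat n"] h1(1)] hpoly3_mult[OF hpoly3_const[of "1 / of_nat n"] h2(1)]
    by (simp_all add: k1_def[abs_def] k2_def[abs_def])
  note pk = hk[THEN hpoly3_poly3]
  define r1 where "r1 = (\<lambda>v. a1 v - ?x v * k1 v, \<lambda>v. b1 v - ?y v * k1 v, \<lambda>v. 0 - ?z v * k1 v)"
  define r2 where "r2 = (\<lambda>v. a2 v - ?x v * k2 v, \<lambda>v. b2 v - ?y v * k2 v, \<lambda>v. 0 - ?z v * k2 v)"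
  have hom1: "hom_triple d1 r1"
    unfolding hom_triple_def r1_def prod.case e1
    using hpoly3_mult[OF hpoly3_coords(1) hk(1)] hpoly3_mult[OF hpoly3_coords(2) hk(1)] hpoly3_mult[OF hpoly3_coords(3) hk(1)]
    by (intro conjI hpoly3_diff hpoly3_zero h[unfolded e1]) simp_all
  have hom2: "hom_triple d2 r2"
    unfolding hom_triple_def r2_def prod.case e2
    using hpoly3_mult[OF hpoly3_coords(1) hk(2)] hpoly3_mult[OF hpoly3_coords(2) hk(2)] hpoly3_mult[OF hpoly3_coords(3) hk(2)]
    by (intro conjI hpoly3_diff hpoly3_zero h[unfolded e2]) simp_all
  have syz1: "syz ?f r1"
    unfolding syz_def r1_def prod.case
  proof (intro conjI allI)
    fix v
    have "(a1 v - ?x v * k1 v) * dx ?f v + (b1 v - ?y v * k1 v) * dy ?f v + (0 - ?z v * k1 v) * dz ?f v =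
      (a1 v * dx ?f v + b1 v * dy ?f v) - k1 v * (?x v * dx ?f v + ?y v * dy ?f v + ?z v * dz ?f v)"
      by (simp add: algebra_simps)
    then show "(a1 v - ?x v * k1 v) * dx ?f v + (b1 v - ?y v * k1 v) * dy ?f v + (0 - ?z v * k1 v) * dz ?f v = 0"
      unfolding h1(2) arr_poly_Euler using n0 by (simp add: k1_def)
  qed (intro poly3_intros p pk)+
  have syz2: "syz ?f r2"
    unfolding syz_def r2_def prod.case
  proof (intro conjI allI)
    fix v
    have "(a2 v - ?x v * k2 v) * dx ?f v + (b2 v - ?y v * k2 v) * dy ?f v + (0 - ?z v * k2 v) * dz ?f v =
      (a2 v * dx ?f v + b2 v * dy ?f v) - k2 v * (?x v * dx ?f v + ?y v * dy ?f v + ?z v * dz ?f v)"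
      by (simp add: algebra_simps)
    then show "(a2 v - ?x v * k2 v) * dx ?f v + (b2 v - ?y v * k2 v) * dy ?f v + (0 - ?z v * k2 v) * dz ?f v = 0"
      unfolding h2(2) arr_poly_Euler using n0 by (simp add: k2_def)
  qed (intro poly3_intros p pk)+
  have ex: "\<exists>g. poly3 (fst g) \<and> poly3 (snd g) \<and> s = lincomb (fst g) r1 (snd g) r2" if s: "syz ?f s" for s
  proof -
    obtain a b c where abc: "s = (a,b,c)" by (cases s)
    have ps: "poly3 a" "poly3 b" "poly3 c" and s0: "\<And>v. a v * dx ?f v + b v * dy ?f v + c v * dz ?f v = 0"
      using s by (auto simp: abc syz_def)
    note tan = syz_tangent[OF L s[unfolded abc]]
    \<comment> \<open>Tangency to the line at infinity makes z divide c; removing c/z times the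
      Euler field leaves a tangent field in the first two components.\<close>
    have "\<exists>q. poly3 q \<and> (\<forall>v. c v = lf (L e) v * q v)"
      by (rule lf_dvd[OF ps(3) nz[OF e(1)]]) (use tan[OF e(1)] e3 in \<open>simp add: lf_alt e\<close>)
    then obtain c0 where c0: "poly3 c0" "\<And>v. c v = lf (L e) v * c0 v" by blast
    define c' where "c' v = L e $ 3 * c0 v" for v
    have c': "poly3 c'" "\<And>v. c v = ?z v * c' v"
      using c0 by (auto simp: c'_def[abs_def] lf_alt e intro!: poly3_intros)
    define a' where "a' v = a v - ?x v * c' v" for v
    define b' where "b' v = b v - ?y v * c' v" for v
    have p': "poly3 a'" "poly3 b'"
      unfolding a'_def[abs_def] b'_def[abs_def] by (intro poly3_intros ps c')+
    have tan': "L i $ 1 * a' v + L i $ 2 * b' v = 0" if "i < n" "lf (L i) v = 0" for i v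
    proof -
      have "L i $ 1 * a' v + L i $ 2 * b' v = lf (L i) (a v, b v, c v) - c' v * lf (L i) v"
        by (simp add: a'_def b'_def c'(2) lf_alt algebra_simps)
      then show ?thesis using tan[OF that] that by simp
    qed
    obtain q1 where q1: "poly3 q1" "\<And>v. a' v * b2 v - a2 v * b' v = Q v * q1 v"
      using Q_dvd[OF p'(1,2) p(3,4) tan' tan2] by blast
    obtain q2 where q2: "poly3 q2" "\<And>v. a1 v * b' v - a' v * b1 v = Q v * q2 v"
      using Q_dvd[OF p(1,2) p'(1,2) tan1 tan'] by blast
    define g1 where "g1 v = q1 v / \<kappa>" for v
    define g2 where "g2 v = q2 v / \<kappa>" for v
    have pg: "poly3 g1" "poly3 g2"
      using poly3_mult[OF poly3_const[of "1/\<kappa>"] q1(1)] poly3_mult[OF poly3_const[of "1/\<kappa>"] q2(1)]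
      by (simp_all add: g1_def[abs_def] g2_def[abs_def])
    have Qa: "Q v * (\<kappa> * a' v) = Q v * (q1 v * a1 v + q2 v * a2 v)" for v
      using det[of v] q1(2)[of v] q2(2)[of v] by algebra
    have Qb: "Q v * (\<kappa> * b' v) = Q v * (q1 v * b1 v + q2 v * b2 v)" for v
      using det[of v] q1(2)[of v] q2(2)[of v] by algebra
    have ea: "\<kappa> * a' v = q1 v * a1 v + q2 v * a2 v" for v
      by (rule Q_cancel[OF _ _ Qa]) (intro poly3_intros p p' q1 q2)+
    have eb: "\<kappa> * b' v = q1 v * b1 v + q2 v * b2 v" for v
      by (rule Q_cancel[OF _ _ Qb]) (intro poly3_intros p p' q1 q2)+
    have a': "a' v = g1 v * a1 v + g2 v * a2 v" and b': "b' v = g1 v * b1 v + g2 v * b2 v" for v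
      using ea[of v] eb[of v] \<kappa> by (simp_all add: g1_def g2_def field_simps)
    \<comment> \<open>The syzygy is applied to f with \<open>s\<close> written in the two fields and
      the Euler field. The multiplier of f must vanish, which determines the Euler
      component.\<close>
    have fc: "?f v * (of_nat n * c' v + g1 v * h1 v + g2 v * h2 v) = 0" for v
    proof -
      have "0 = (a' v + ?x v * c' v) * dx ?f v + (b' v + ?y v * c' v) * dy ?f v + ?z v * c' v * dz ?f v"
        using s0[of v] by (simp add: a'_def b'_def c')
      also have "\<dots> = c' v * (?x v * dx ?f v + ?y v * dy ?f v + ?z v * dz ?f v) +
        g1 v * (a1 v * dx ?f v + b1 v * dy ?f v) + g2 v * (a2 v * dx ?f v + b2 v * dy ?f v)"
        unfolding a' b' by (simp add: algebra_simps)
      also have "\<dots> = ?f v * (of_nat n * c' v + g1 v * h1 v + g2 v * h2 v)"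
        unfolding arr_poly_Euler h1(2) h2(2) by (simp add: algebra_simps)
      finally show ?thesis by simp
    qed
    have "of_nat n * c' v + g1 v * h1 v + g2 v * h2 v = 0" for v
      by (rule lf_prod_cancel[of "{..<n}" L "\<lambda>v. of_nat n * c' v + g1 v * h1 v + g2 v * h2 v"])
        (use nz fc in \<open>auto simp: arr_poly_lf intro!: poly3_intros c' pg ph\<close>)
    then have c'': "c' v = - (g1 v * k1 v + g2 v * k2 v)" for v
      using n0 by (simp add: k1_def k2_def field_simps add_eq_0_iff)
    have "a v = g1 v * (a1 v - ?x v * k1 v) + g2 v * (a2 v - ?x v * k2 v)"
      "b v = g1 v * (b1 v - ?y v * k1 v) + g2 v * (b2 v - ?y v * k2 v)"
      "c v = g1 v * (0 - ?z v * k1 v) + g2 v * (0 - ?z v * k2 v)" for v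
      using a'[of v] b'[of v] unfolding a'_def b'_def c'(2) c'' by (simp_all add: algebra_simps)
    then have "s = lincomb g1 r1 g2 r2" by (simp add: abc lincomb_def r1_def r2_def fun_eq_iff)
    then show ?thesis using pg by (intro exI[of _ "(g1,g2)"]) simp
  qed
  \<comment> \<open>The third component of a relation, divided by z, shows that the Euler
    corrections cancel. What is left is a homogeneous 2 by 2 system with determinant \<kappa>
    Q.\<close>
  have uniq: "g = g'" if g: "poly3 (fst g)" "poly3 (snd g)" and g': "poly3 (fst g')" "poly3 (snd g')"
    and eq: "lincomb (fst g) r1 (snd g) r2 = lincomb (fst g') r1 (snd g') r2" for g g'
  proof -
    define u where "u v = fst g v - fst g' v" for v
    define t where "t v = snd g v - snd g' v" for v
    have pu: "poly3 u" "poly3 t"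
      unfolding u_def[abs_def] t_def[abs_def] by (intro poly3_diff g g')+
    have eqs: "u v * (a1 v - ?x v * k1 v) + t v * (a2 v - ?x v * k2 v) = 0"
      "u v * (b1 v - ?y v * k1 v) + t v * (b2 v - ?y v * k2 v) = 0"
      "u v * (0 - ?z v * k1 v) + t v * (0 - ?z v * k2 v) = 0" for v
      using fun_cong[OF arg_cong[OF eq, of fst], of v] fun_cong[OF arg_cong[OF eq, of "fst \<circ> snd", unfolded comp_apply], of v]
        fun_cong[OF arg_cong[OF eq, of "snd \<circ> snd", unfolded comp_apply], of v]
      unfolding lincomb_def r1_def r2_def prod.case fst_conv snd_conv u_def t_def
      by algebra+
    have "?z v * (u v * k1 v + t v * k2 v) = ?z v * 0" for v
      using eqs(3)[of v] by algebra
    then have k0: "u v * k1 v + t v * k2 v = 0" for v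
      by (rule z_cancel[rotated 2]) (intro poly3_intros pu pk)+
    have 1: "u v * a1 v + t v * a2 v = 0" "u v * b1 v + t v * b2 v = 0" for v
      using eqs[of v] k0[of v] by algebra+
    have Qu: "Q v * (\<kappa> * u v) = Q v * 0" and Qt: "Q v * (\<kappa> * t v) = Q v * 0" for v
      using 1[of v] det[of v] by algebra+
    have "\<kappa> * u v = 0" for v by (rule Q_cancel[OF _ _ Qu]) (intro poly3_intros pu)+
    moreover have "\<kappa> * t v = 0" for v by (rule Q_cancel[OF _ _ Qt]) (intro poly3_intros pu)+
    ultimately
    have "u v = 0" "t v = 0" for v using \<kappa> by auto
    then show ?thesis by (simp add: u_def t_def prod_eq_iff fun_eq_iff)
  qed
  show ?thesis
    unfolding free_curve_def
  proof (rule conjI[OF d(2)], rule exI[of _ r1], rule exI[of _ r2], intro conjI hom1 hom2 syz1 syz2 allI impI)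
    fix s assume "syz ?f s"
    with ex obtain g where "poly3 (fst g) \<and> poly3 (snd g) \<and> s = lincomb (fst g) r1 (snd g) r2" by blast
    then show "\<exists>!g. poly3 (fst g) \<and> poly3 (snd g) \<and> s = lincomb (fst g) r1 (snd g) r2"
      using uniq by (intro ex1I[of _ g]) auto
  qed
qed

section \<open>The arrangement and its multiple points\<close>

text \<open>The pair \<open>(a, b)\<close> of type \<open>z2\<close> stands for \<open>a + b \<surd>2\<close>; evaluating at either square root
  of \<open>2\<close> gives the arrangement and its Galois conjugate.\<close>

type_synonym z2 = "int \<times> int"

fun zadd :: "z2 \<Rightarrow> z2 \<Rightarrow> z2" where
  "zadd (a,b) (c,d) = (a + c, b + d)"

fun zsub :: "z2 \<Rightarrow> z2 \<Rightarrow> z2" where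
  "zsub (a,b) (c,d) = (a - c, b - d)"

fun zmul :: "z2 \<Rightarrow> z2 \<Rightarrow> z2" where
  "zmul (a,b) (c,d) = (a * c + 2 * (b * d), a * d + b * c)"

fun zdot :: "z2 \<times> z2 \<times> z2 \<Rightarrow> z2 \<times> z2 \<times> z2 \<Rightarrow> z2" where
  "zdot (a,b,c) (x,y,z) = zadd (zmul a x) (zadd (zmul b y) (zmul c z))"

fun zcross :: "z2 \<times> z2 \<times> z2 \<Rightarrow> z2 \<times> z2 \<times> z2 \<Rightarrow> z2 \<times> z2 \<times> z2" where
  "zcross (a,b,c) (x,y,z) =
    (zsub (zmul b z) (zmul c y), zsub (zmul c x) (zmul a z), zsub (zmul a y) (zmul b x))"

definition zzero :: "z2 \<times> z2 \<times> z2" where "zzero = ((0,0),(0,0),(0,0))"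

definition ev :: "'a::field_char_0 \<Rightarrow> z2 \<Rightarrow> 'a" where
  "ev s x = of_int (fst x) + of_int (snd x) * s"

definition evv :: "'a::field_char_0 \<Rightarrow> z2 \<times> z2 \<times> z2 \<Rightarrow> 'a^3" where
  "evv s l = vector [ev s (fst l), ev s (fst (snd l)), ev s (snd (snd l))]"

lemma evv_nth [simp]:
  "evv s l $ 1 = ev s (fst l)" "evv s l $ 2 = ev s (fst (snd l))" "evv s l $ 3 = ev s (snd (snd l))"
  by (simp_all add: evv_def)

lemma ev_zadd: "ev s (zadd x y) = ev s x + ev s y"
  by (cases x; cases y) (simp add: ev_def algebra_simps)

lemma ev_zsub: "ev s (zsub x y) = ev s x - ev s y"
  by (cases x; cases y) (simp add: ev_def algebra_simps)

lemma ev_zmul: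
  assumes "s * s = 2"
  shows "ev s (zmul x y) = ev s x * ev s y"
proof -
  obtain a b c d where "x = (a,b)" "y = (c,d)" by (cases x; cases y)
  moreover have "(of_int b * s) * (of_int d * s) = of_int b * of_int d * (2::'a)"
    by (simp add: assms[symmetric] mult_ac)
  ultimately show ?thesis by (simp add: ev_def algebra_simps)
qed

text \<open>For nonzero a and b the exponent of 2 is even on the left and odd on the right.\<close>

lemma square_eq_twice_square:
  fixes a b :: int
  assumes "a * a = 2 * (b * b)"
  shows "a = 0 \<and> b = 0"
proof (rule ccontr)
  assume "\<not> ?thesis"
  with assms have nz: "a \<noteq> 0" "b \<noteq> 0" by auto
  have p: "prime (2::int)" by simp
  have "multiplicity 2 (a * a) = 2 * multiplicity 2 a"
    using nz p by (simp add: prime_elem_multiplicity_mult_distrib)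
  moreover have "multiplicity 2 (2 * (b * b)) = Suc (2 * multiplicity 2 b)"
    using nz p by (simp add: prime_elem_multiplicity_mult_distrib)
  ultimately have "2 * multiplicity 2 a = Suc (2 * multiplicity 2 b)" using assms by simp
  then show False by presburger
qed

lemma ev_eq_0_iff:
  assumes "s * s = (2::'a::field_char_0)"
  shows "ev s x = 0 \<longleftrightarrow> x = (0,0)"
proof
  assume *: "ev s x = 0"
  obtain a b where x: "x = (a,b)" by (cases x)
  have "of_int a = - (of_int b * s)" using * by (simp add: x ev_def add_eq_0_iff)
  then have "of_int (a * a) = (of_int b * of_int b) * (s * s)" by (simp add: mult_ac)
  also have "\<dots> = of_int (2 * (b * b))" by (simp add: assms)
  finally have "a * a = 2 * (b * b)" by (simp only: of_int_eq_iff)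
  then show "x = (0,0)" using square_eq_twice_square x by simp
qed (simp add: ev_def)

lemma evv_eq_0_iff:
  assumes "s * s = (2::'a::field_char_0)"
  shows "evv s l = 0 \<longleftrightarrow> l = zzero"
  by (cases l) (auto simp: vec3_eq_iff ev_eq_0_iff[OF assms] zzero_def)

definition dot3 :: "'a::comm_ring_1^3 \<Rightarrow> 'a^3 \<Rightarrow> 'a" where
  "dot3 u v = u$1 * v$1 + u$2 * v$2 + u$3 * v$3"

text \<open>Serves both as the meet of two lines and as the join of two points. It is bilinear,
  without conjugation, so that real and complex coordinates are treated alike.\<close>

definition crossp :: "'a::comm_ring_1^3 \<Rightarrow> 'a^3 \<Rightarrow> 'a^3" where
  "crossp u v = vector [u$2 * v$3 - u$3 * v$2, u$3 * v$1 - u$1 * v$3, u$1 * v$2 - u$2 * v$1]"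

lemma crossp_nth [simp]:
  "crossp u v $ 1 = u$2 * v$3 - u$3 * v$2" "crossp u v $ 2 = u$3 * v$1 - u$1 * v$3"
  "crossp u v $ 3 = u$1 * v$2 - u$2 * v$1"
  by (simp_all add: crossp_def)

lemma dot3_evv: "s * s = 2 \<Longrightarrow> dot3 (evv s l) (evv s q) = ev s (zdot l q)"
  by (cases l; cases q) (simp add: dot3_def ev_zadd ev_zmul del: zadd.simps zmul.simps)

lemma crossp_evv: "s * s = 2 \<Longrightarrow> crossp (evv s l) (evv s q) = evv s (zcross l q)"
  by (cases l; cases q) (simp add: vec3_eq_iff ev_zsub ev_zmul del: zsub.simps zmul.simps)

lemma crossp_eq_0_dependent:
  fixes u v :: "'a::field^3"
  assumes "crossp u v = 0" "v \<noteq> 0"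
  shows "\<exists>c. u = c *s v"
proof -
  have e: "u$2 * v$3 = u$3 * v$2" "u$3 * v$1 = u$1 * v$3" "u$1 * v$2 = u$2 * v$1"
    using assms(1) by (simp_all add: vec3_eq_iff)
  consider "v$1 \<noteq> 0" | "v$2 \<noteq> 0" | "v$3 \<noteq> 0"
    using assms(2) by (auto simp: vec3_eq_iff)
  then show ?thesis
  proof cases
    case 1 then show ?thesis using e by (intro exI[of _ "u$1 / v$1"]) (simp add: vec3_eq_iff field_simps)
  next
    case 2 then show ?thesis using e by (intro exI[of _ "u$2 / v$2"]) (simp add: vec3_eq_iff field_simps)
  next
    case 3 then show ?thesis using e by (intro exI[of _ "u$3 / v$3"]) (simp add: vec3_eq_iff field_simps)
  qed
qed

lemma dependent_crossp_eq_0: "u = c *s v \<Longrightarrow> crossp u v = 0"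
  by (simp add: vec3_eq_iff algebra_simps)

text \<open>Both vectors are multiples of the cross product: two distinct lines have one common
  point, and dually.\<close>

lemma orthogonal_two_parallel:
  fixes u v p q :: "'a::field^3"
  assumes "crossp u v \<noteq> 0" "q \<noteq> 0"
    "dot3 u p = 0" "dot3 v p = 0" "dot3 u q = 0" "dot3 v q = 0"
  shows "\<exists>c. p = c *s q"
proof -
  let ?n = "crossp u v"
  have "crossp p ?n = 0" "crossp q ?n = 0"
    using assms(3-6) unfolding dot3_def vec3_eq_iff crossp_nth zero_index by (intro conjI; algebra)+
  then obtain a b where "p = a *s ?n" "q = b *s ?n"
    using crossp_eq_0_dependent assms(1) by metis
  moreover from this have "b \<noteq> 0" using assms(2) by (auto simp: vec_eq_iff)
  ultimately have "p = (a / b) *s q" by (simp add: vec_eq_iff)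
  then show ?thesis by blast
qed

text \<open>For s = \<surd>2 these are the values tan (k \<pi>/8) with k from -3 to 3. The set is
  stable under conjugation, which exchanges s - 1 with -1 - s and 1 - s with 1 + s.\<close>

definition offsets :: "z2 list" where
  "offsets = [(0,0), (1,0), (-1,0), (-1,1), (1,-1), (1,1), (-1,-1)]"

text \<open>Index 0 is the line at infinity. The blocks 1-7, 8-14, 15-21 and 22-28 are the four
  parallel classes, each starting with its mirror; 29-32 are the other mirrors. The diagonal classes
  carry a factor \<surd>2 because the normals (1,1) and (1,-1) have that length.\<close>

definition lines :: "(z2 \<times> z2 \<times> z2) list" where
  "lines = [((0,0),(0,0),(1,0))]
    @ map (\<lambda>a. ((1,0), (0,0), zmul (-1,0) a)) offsets
    @ map (\<lambda>a. ((0,0), (1,0), zmul (-1,0) a)) offsets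
    @ map (\<lambda>a. ((1,0), (1,0), zmul (0,-1) a)) offsets
    @ map (\<lambda>a. ((1,0), (-1,0), zmul (0,-1) a)) offsets
    @ [((-1,1),(-1,0),(0,0)), ((-1,1),(1,0),(0,0)), ((1,0),(1,-1),(0,0)), ((1,0),(-1,1),(0,0))]"

definition O33 :: "'a::field_char_0 \<Rightarrow> nat \<Rightarrow> 'a^3" where
  "O33 s i = evv s (lines ! i)"

lemma length_lines: "length lines = 33"
  by code_simp

fun pairwise_indep :: "(z2 \<times> z2 \<times> z2) list \<Rightarrow> bool" where
  "pairwise_indep [] = True"
| "pairwise_indep (l # ls) = (list_all (\<lambda>m. zcross l m \<noteq> zzero) ls \<and> pairwise_indep ls)"

lemma pairwise_indep_nth:
  "pairwise_indep ls \<Longrightarrow> i < j \<Longrightarrow> j < length ls \<Longrightarrow> zcross (ls ! i) (ls ! j) \<noteq> zzero"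
proof (induction ls arbitrary: i j)
  case (Cons l ls)
  then show ?case by (cases i; cases j) (auto simp: list_all_iff)
qed simp

lemma pairwise_indep_lines: "pairwise_indep lines"
  by code_simp

lemma lines_nonzero: "list_all (\<lambda>l. l \<noteq> zzero) lines"
  by code_simp

lemma O33_nonzero: "s * s = 2 \<Longrightarrow> i < 33 \<Longrightarrow> O33 s i \<noteq> 0"
  using lines_nonzero length_lines by (auto simp: O33_def evv_eq_0_iff list_all_length)

lemma O33_crossp_nonzero:
  assumes s: "s * s = 2" and "i < 33" "j < 33" "i \<noteq> j"
  shows "crossp (O33 s i) (O33 s j) \<noteq> 0"
proof -
  have *: "crossp (O33 s i) (O33 s j) \<noteq> 0" if "i < j" "j < 33" for i j
    using pairwise_indep_nth[OF pairwise_indep_lines that(1)] that(2)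
    by (simp add: O33_def crossp_evv[OF s] evv_eq_0_iff[OF s] length_lines)
  have "crossp (O33 s j) (O33 s i) = - crossp (O33 s i) (O33 s j)"
    by (simp add: vec3_eq_iff algebra_simps)
  then show ?thesis using *[of i j] *[of j i] assms by (cases i j rule: linorder_cases) auto
qed

lemma line_arr_O33: "s * s = 2 \<Longrightarrow> line_arr 33 (O33 s)"
  unfolding line_arr_def using O33_nonzero O33_crossp_nonzero dependent_crossp_eq_0 by blast

lemma cplx_O33: "cplx (O33 s) = O33 (complex_of_real s)"
  by (auto simp: cplx_def O33_def fun_eq_iff vec3_eq_iff ev_def)

text \<open>One representative for each of the 169 multiple points, in the order of
  \<open>incidences\<close>. Together the two lists form a certificate that is checked by
  evaluation.\<close>

definition points :: "(z2 \<times> z2 \<times> z2) list" where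
  "points = [
    ((0,0),(1,0),(0,0)), ((1,0),(0,0),(0,0)), ((-1,0),(1,0),(0,0)), ((1,0),(1,0),(0,0)), ((1,1),(1,0),(0,0)),
    ((1,0),(1,-1),(0,0)), ((1,0),(1,1),(0,0)), ((-1,0),(1,1),(0,0)), ((0,0),(0,0),(1,0)), ((0,0),(1,0),(1,0)),
    ((0,0),(-1,0),(1,0)), ((0,0),(1,0),(1,1)), ((0,0),(-1,0),(1,1)), ((0,0),(1,1),(1,0)), ((0,0),(1,0),(1,-1)),
    ((0,0),(0,1),(1,0)), ((0,0),(0,-1),(1,0)), ((0,0),(0,1),(1,1)), ((0,0),(0,-1),(1,1)), ((0,0),(0,1),(-1,1)),
    ((0,0),(0,1),(1,-1)), ((1,0),(0,0),(1,0)), ((1,0),(1,0),(1,0)), ((1,0),(-1,0),(1,0)), ((1,0),(-1,1),(1,0)),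
    ((1,0),(1,-1),(1,0)), ((1,0),(1,1),(1,0)), ((-1,0),(1,1),(-1,0)), ((1,0),(-3,1),(1,0)),
    ((-1,0),(3,1),(-1,0)), ((1,0),(3,-1),(1,0)), ((1,0),(3,1),(1,0)), ((-1,0),(0,0),(1,0)),
    ((-1,0),(1,0),(1,0)), ((1,0),(1,0),(-1,0)), ((-1,0),(-1,1),(1,0)), ((-1,0),(1,-1),(1,0)),
    ((-1,0),(1,1),(1,0)), ((1,0),(1,1),(-1,0)), ((-1,0),(3,-1),(1,0)), ((-1,0),(3,1),(1,0)),
    ((-1,0),(-3,1),(1,0)), ((1,0),(3,1),(-1,0)), ((1,0),(0,0),(1,1)), ((-1,1),(1,0),(1,0)),
    ((-1,1),(-1,0),(1,0)), ((1,0),(1,0),(1,1)), ((1,0),(-1,0),(1,1)), ((-1,1),(1,1),(1,0)),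
    ((1,-1),(1,1),(-1,0)), ((-1,1),(1,-2),(1,0)), ((1,0),(-1,1),(1,1)), ((-1,1),(3,0),(1,0)),
    ((1,-1),(1,2),(-1,0)), ((-1,1),(-1,2),(1,0)), ((1,0),(1,-1),(1,1)), ((-1,1),(-3,0),(1,0)),
    ((-1,1),(1,2),(1,0)), ((-1,0),(0,0),(1,1)), ((1,-1),(1,0),(1,0)), ((-1,1),(1,0),(-1,0)),
    ((-1,0),(1,0),(1,1)), ((-1,0),(-1,0),(1,1)), ((1,-1),(1,1),(1,0)), ((-1,1),(1,1),(-1,0)),
    ((1,-1),(-1,2),(1,0)), ((-1,0),(1,-1),(1,1)), ((1,-1),(1,2),(1,0)), ((-1,1),(3,0),(-1,0)),
    ((1,-1),(1,-2),(1,0)), ((-1,0),(-1,1),(1,1)), ((-1,1),(1,2),(-1,0)), ((1,-1),(3,0),(1,0)),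
    ((1,1),(0,0),(1,0)), ((1,1),(1,0),(1,0)), ((1,1),(-1,0),(1,0)), ((1,1),(-1,1),(1,0)), ((1,1),(1,-1),(1,0)),
    ((1,0),(1,0),(-1,1)), ((-1,0),(1,0),(1,-1)), ((1,1),(-1,-2),(1,0)), ((1,1),(1,-2),(1,0)),
    ((1,1),(-3,0),(1,0)), ((-1,0),(1,1),(1,-1)), ((1,1),(1,2),(1,0)), ((1,1),(-1,2),(1,0)), ((1,1),(3,0),(1,0)),
    ((1,0),(1,1),(-1,1)), ((1,0),(0,0),(1,-1)), ((-1,-1),(1,0),(1,0)), ((1,1),(1,0),(-1,0)),
    ((1,1),(1,-1),(-1,0)), ((1,1),(-1,1),(-1,0)), ((-1,0),(1,0),(-1,1)), ((1,0),(1,0),(1,-1)),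
    ((-1,-1),(1,2),(1,0)), ((-1,-1),(3,0),(1,0)), ((1,1),(1,-2),(-1,0)), ((-1,0),(1,1),(-1,1)),
    ((1,1),(1,2),(-1,0)), ((1,1),(3,0),(-1,0)), ((1,1),(-1,2),(-1,0)), ((1,0),(1,1),(1,-1)),
    ((0,1),(0,0),(1,0)), ((0,-1),(0,0),(1,0)), ((0,1),(0,0),(1,1)), ((0,-1),(0,0),(1,1)), ((0,1),(0,0),(-1,1)),
    ((0,1),(0,0),(1,-1)), ((-3,1),(1,0),(1,0)), ((-3,-1),(1,0),(1,0)), ((3,-1),(1,0),(1,0)),
    ((3,1),(1,0),(1,0)), ((-3,1),(1,0),(-1,0)), ((3,1),(-1,0),(1,0)), ((-3,1),(-1,0),(1,0)),
    ((3,1),(1,0),(-1,0)), ((1,-2),(-1,1),(1,0)), ((-1,1),(1,0),(1,1)), ((3,0),(-1,1),(1,0)),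
    ((1,2),(1,-1),(-1,0)), ((-1,2),(-1,1),(1,0)), ((1,-1),(1,0),(1,1)), ((1,2),(-1,1),(1,0)),
    ((-3,0),(-1,1),(1,0)), ((-1,2),(1,-1),(1,0)), ((1,-1),(-1,0),(1,1)), ((1,2),(1,-1),(1,0)),
    ((-3,0),(1,-1),(1,0)), ((1,-2),(1,-1),(1,0)), ((-1,1),(-1,0),(1,1)), ((3,0),(1,-1),(1,0)),
    ((1,2),(-1,1),(-1,0)), ((-1,-2),(1,1),(1,0)), ((1,-2),(1,1),(1,0)), ((-3,0),(1,1),(1,0)),
    ((1,1),(-1,0),(1,-1)), ((1,2),(1,1),(1,0)), ((3,0),(1,1),(1,0)), ((-1,2),(1,1),(1,0)), ((1,1),(1,0),(-1,1)),
    ((1,2),(-1,-1),(1,0)), ((-3,0),(1,1),(-1,0)), ((1,-2),(1,1),(-1,0)), ((1,1),(-1,0),(-1,1)),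
    ((1,2),(1,1),(-1,0)), ((-1,2),(1,1),(-1,0)), ((3,0),(1,1),(-1,0)), ((1,1),(1,0),(1,-1)),
    ((1,0),(-1,0),(0,1)), ((-1,0),(1,0),(0,1)), ((1,0),(-1,0),(2,1)), ((-1,0),(1,0),(2,1)),
    ((-1,0),(1,0),(-2,1)), ((-1,-1),(1,1),(0,1)), ((1,0),(1,0),(0,1)), ((1,0),(1,0),(0,-1)),
    ((1,0),(1,0),(2,1)), ((2,0),(0,-1),(1,0)), ((0,-1),(2,0),(1,0)), ((-1,0),(-1,0),(2,1)),
    ((0,1),(-2,0),(1,0)), ((-2,0),(0,1),(1,0)), ((1,1),(1,1),(0,1)), ((2,0),(0,1),(1,0)), ((0,1),(2,0),(1,0)),
    ((1,0),(1,0),(-2,1)), ((0,1),(2,0),(-1,0)), ((2,0),(0,1),(-1,0))]"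

definition incidences :: "nat list list" where
  "incidences = [
    [0,1,2,3,4,5,6,7], [0,8,9,10,11,12,13,14], [0,15,16,17,18,19,20,21], [0,22,23,24,25,26,27,28], [0,29],
    [0,30], [0,31], [0,32], [1,8,15,22,29,30,31,32], [1,9], [1,10], [1,11], [1,12], [1,13], [1,14], [1,16,24],
    [1,17,23], [1,18,26], [1,19,25], [1,20,28], [1,21,27], [2,8], [2,9,22], [2,10,15], [2,11,16,25,29],
    [2,12,18,23,30], [2,13,20,24,31], [2,14,17,27,32], [2,19], [2,21], [2,26], [2,28], [3,8], [3,9,15],
    [3,10,22], [3,11,19,24,30], [3,12,17,26,29], [3,13,16,28,32], [3,14,21,23,31], [3,18], [3,20], [3,25],
    [3,27], [4,8], [4,9,16,26,31], [4,10,19,23,32], [4,11,22], [4,12,15], [4,13], [4,14], [4,17], [4,18,29],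
    [4,20], [4,21], [4,24], [4,25,30], [4,27], [4,28], [5,8], [5,9,18,24,32], [5,10,17,25,31], [5,11,15],
    [5,12,22], [5,13], [5,14], [5,16], [5,19,29], [5,20], [5,21], [5,23], [5,26,30], [5,27], [5,28], [6,8],
    [6,9,20,23,29], [6,10,16,27,30], [6,11], [6,12], [6,13,22], [6,14,15], [6,17], [6,18], [6,19], [6,21,32],
    [6,24], [6,25], [6,26], [6,28,31], [7,8], [7,9,17,28,30], [7,10,21,24,29], [7,11], [7,12], [7,13,15],
    [7,14,22], [7,16], [7,18], [7,19], [7,20,32], [7,23], [7,25], [7,26], [7,27,31], [8,16,23], [8,17,24],
    [8,18,25], [8,19,26], [8,20,27], [8,21,28], [9,19], [9,21], [9,25], [9,27], [10,18], [10,20], [10,26],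
    [10,28], [11,17], [11,18,31], [11,20], [11,21], [11,23], [11,26,32], [11,27], [11,28], [12,16], [12,19,31],
    [12,20], [12,21], [12,24], [12,25,32], [12,27], [12,28], [13,17], [13,18], [13,19], [13,21,30], [13,23],
    [13,25], [13,26], [13,27,29], [14,16], [14,18], [14,19], [14,20,30], [14,24], [14,25], [14,26], [14,28,29],
    [15,23], [15,24], [15,25], [15,26], [15,27], [15,28], [16,22], [17,22], [18,22], [18,27], [18,28], [19,22],
    [19,27], [19,28], [20,22], [20,25], [20,26], [21,22], [21,25], [21,26]]"

definition inc :: "z2 \<times> z2 \<times> z2 \<Rightarrow> nat list" where
  "inc q = map fst (filter (\<lambda>(i,l). zdot l q = (0,0)) (zip [0..<33] lines))"

lemma inc_points: "map inc points = incidences"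
  by code_simp

lemma points_nonzero: "list_all (\<lambda>q. q \<noteq> zzero) points"
  by code_simp

text \<open>Completeness of the table: every two lines meet in a listed point, so no multiple point
  is missing.\<close>

lemma incidences_cover:
  "list_all (\<lambda>i. list_all (\<lambda>j. j \<in> set (concat (filter (\<lambda>l. i \<in> set l) incidences))) [0..<33]) [0..<33]"
  by code_simp

lemma distinct_incidences: "distinct incidences"
  by code_simp

lemma length_incidences:
  "list_all (\<lambda>l. length l \<in> {2,3,5,8}) incidences"
  "length (filter (\<lambda>l. length l = 2) incidences) = 108"
  "length (filter (\<lambda>l. length l = 3) incidences) = 40"
  "length (filter (\<lambda>l. length l = 5) incidences) = 16"
  "length (filter (\<lambda>l. length l = 8) incidences) = 5"
  by code_simp+

lemma set_inc: "set (inc q) = {i. i < 33 \<and> zdot (lines ! i) q = (0,0)}"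
  by (auto simp: inc_def set_zip length_lines intro!: image_eqI rev_image_eqI)

lemma sorted_inc: "sorted (inc q) \<and> distinct (inc q)"
proof -
  have "map fst (zip [0..<33] lines) = [0..<33]" by (simp add: length_lines)
  moreover have "sorted (map fst (filter P xs)) \<and> distinct (map fst (filter P xs))"
    if "sorted (map fst xs) \<and> distinct (map fst xs)" for P and xs :: "(nat \<times> z2 \<times> z2 \<times> z2) list"
    using that by (induction xs) auto
  ultimately show ?thesis unfolding inc_def by (metis distinct_upt sorted_upt)
qed

lemma inner_dot3: "u \<bullet> v = dot3 u (v :: real^3)"
  by (simp add: inner_vec_def sum_3 dot3_def)

lemma incident_O33:
  "{i. i < 33 \<and> O33 (sqrt 2) i \<bullet> evv (sqrt 2) q = 0} = set (inc q)"
  by (simp add: set_inc inner_dot3 O33_def dot3_evv ev_eq_0_iff)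

text \<open>Two of the lines through \<open>p\<close> already meet in a listed point, and their meet
  is unique up to a scalar, so the full set of lines through \<open>p\<close> is the listed
  one.\<close>

lemma incident_set_cases:
  assumes "p \<noteq> 0" and S: "S = {i. i < 33 \<and> O33 (sqrt 2) i \<bullet> p = 0}" and "2 \<le> card S"
  shows "\<exists>l\<in>set incidences. S = set l"
proof -
  let ?s = "sqrt 2"
  have s: "?s * ?s = 2" by simp
  obtain i j where ij: "i \<in> S" "j \<in> S" "i \<noteq> j"
    using assms(3) by (metis One_nat_def Suc_1 card_le_Suc0_iff_eq card.infinite not_less_eq_eq zero_le)
  then have ij33: "i < 33" "j < 33" by (auto simp: S)
  then have "j \<in> set (concat (filter (\<lambda>l. i \<in> set l) incidences))"
    using incidences_cover by (simp add: list_all_iff)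
  then obtain l where l: "l \<in> set incidences" "i \<in> set l" "j \<in> set l" by auto
  then obtain q where q: "q \<in> set points" "l = inc q"
    unfolding inc_points[symmetric] by auto
  have "evv ?s q \<noteq> 0" using points_nonzero q(1) by (auto simp: list_all_iff evv_eq_0_iff)
  moreover have "O33 ?s i \<bullet> evv ?s q = 0" "O33 ?s j \<bullet> evv ?s q = 0"
    using l incident_O33[of q] by (auto simp: q(2))
  ultimately obtain c where c: "p = c *s evv ?s q"
    using orthogonal_two_parallel[OF O33_crossp_nonzero[OF s ij33 ij(3)], of "evv ?s q" p] ij
    by (auto simp: S inner_dot3)
  then have "c \<noteq> 0" using assms(1) by (auto simp: vec_eq_iff)
  moreover have "O33 ?s k \<bullet> p = c * (O33 ?s k \<bullet> evv ?s q)" for k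
    by (simp add: c inner_dot3 dot3_def algebra_simps)
  ultimately have "S = set l" unfolding S q(2) incident_O33[symmetric] by auto
  then show ?thesis using l(1) by blast
qed

text \<open>The lists in the table are sorted and without repetition, hence determined by their
  sets; this turns the cardinality of a set of sets into the length of a list.\<close>

lemma nk_O33:
  assumes "2 \<le> k"
  shows "nk 33 (O33 (sqrt 2)) k = length (filter (\<lambda>l. length l = k) incidences)"
proof -
  have sd: "sorted l \<and> distinct l" if "l \<in> set incidences" for l
    using that sorted_inc unfolding inc_points[symmetric] by auto
  have ex: "\<exists>p::real^3. p \<noteq> 0 \<and> set l = {i. i < 33 \<and> O33 (sqrt 2) i \<bullet> p = 0}" if "l \<in> set incidences" for l
  proof -
    obtain q where q: "q \<in> set points" "l = inc q" using \<open>l \<in> _\<close> unfolding inc_points[symmetric] by auto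
    then have "evv (sqrt 2) q \<noteq> 0" using points_nonzero by (auto simp: list_all_iff evv_eq_0_iff)
    then show ?thesis using incident_O33[of q] q(2) by blast
  qed
  have "{S. \<exists>p::real^3. p \<noteq> 0 \<and> S = {i. i < 33 \<and> O33 (sqrt 2) i \<bullet> p = 0} \<and> card S = k}
      = set ` set (filter (\<lambda>l. length l = k) incidences)" (is "?A = ?B")
  proof
    show "?A \<subseteq> ?B"
    proof
      fix S assume "S \<in> ?A"
      then obtain p where p: "p \<noteq> 0" "S = {i. i < 33 \<and> O33 (sqrt 2) i \<bullet> p = 0}" "card S = k" by blast
      then obtain l where "l \<in> set incidences" "S = set l" using incident_set_cases[of p S] assms by auto
      then show "S \<in> ?B" using p(3) sd[of l] by (auto simp: distinct_card)
    qed
    show "?B \<subseteq> ?A"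
      using ex sd by (fastforce simp: distinct_card)
  qed
  moreover have "inj_on set (set (filter (\<lambda>l. length l = k) incidences))"
    using sd by (auto simp: inj_on_def intro: sorted_distinct_set_unique)
  ultimately show ?thesis
    unfolding nk_def using distinct_card[OF distinct_filter[OF distinct_incidences, of "\<lambda>l. length l = k"]]
    by (simp add: card_image)
qed

lemma nk_O33_values:
  "nk 33 (O33 (sqrt 2)) 2 = 108" "nk 33 (O33 (sqrt 2)) 3 = 40" "nk 33 (O33 (sqrt 2)) 5 = 16"
  "nk 33 (O33 (sqrt 2)) 8 = 5" "2 \<le> k \<Longrightarrow> k \<notin> {2,3,5,8} \<Longrightarrow> nk 33 (O33 (sqrt 2)) k = 0"
  using length_incidences by (auto simp: nk_O33 filter_empty_conv list_all_iff)

section \<open>Freeness\<close>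

text \<open>Writing \<open>w = x + \<i>y\<close>, the arrangement is invariant under the dihedral group generated by
  \<open>w \<mapsto> \<zeta> w\<close> (\<open>\<zeta>\<close> a primitive eighth root of unity) and complex conjugation. The fields have the form
  \<open>A w + B cnj w ^ 7\<close> with \<open>A\<close>, \<open>B\<close> polynomials in the invariants \<open>N = |w|\<^sup>2\<close>, \<open>T = Re w ^ 8\<close> and
  \<open>Z = z\<^sup>2\<close>; they are automatically tangent to the eight mirrors. On \<open>x = a z\<close> tangency reads
  \<open>A + B P = 0\<close>, where \<open>Re w ^ 7 = x P(N, x\<^sup>2)\<close>, and it is needed for the three values \<open>X = a\<^sup>2 Z\<close> with
  \<open>X\<^sup>3 - 7 X\<^sup>2 Z + 7 X Z\<^sup>2 - Z\<^sup>3 = 0\<close>. The coefficients solve this linear system.\<close>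

definition A1 :: "complex \<Rightarrow> complex \<Rightarrow> complex \<Rightarrow> complex" where
  "A1 N T Z = 147*N^7 - 5544*N^6*Z + 70224*N^5*Z^2 - 382656*N^4*Z^3 + 907136*N^3*Z^4 - 838656*N^2*Z^5 +
    260096*N*Z^6 - 24576*Z^7 + 77*N^3*T - 1848*N^2*T*Z + 16016*N*T*Z^2 - 45888*T*Z^3"

definition B1 :: "complex \<Rightarrow> complex \<Rightarrow> complex \<Rightarrow> complex" where
  "B1 N T Z = 29*N^4 - 1056*N^3*Z + 12320*N^2*Z^2 - 57600*N*Z^3 + 91776*Z^4 + 3*T"

definition A2 :: "complex \<Rightarrow> complex \<Rightarrow> complex \<Rightarrow> complex" where
  "A2 N T Z = - 651*N^8 + 36288*N^7*Z - 756672*N^6*Z^2 + 7380480*N^5*Z^3 - 35180288*N^4*Z^4 + 77881344*N^3*Z^5 -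
    69853184*N^2*Z^6 + 21430272*N*Z^7 - 2015232*Z^8 - 266*N^4*T + 12096*N^3*T*Z - 203840*N^2*T*Z^2 +
    1473024*N*T*Z^3 - 3747072*T*Z^4 + 21*T^2"

definition B2 :: "complex \<Rightarrow> complex \<Rightarrow> complex \<Rightarrow> complex" where
  "B2 N T Z = - 128*N^5 + 6912*N^4*Z - 137216*N^3*Z^2 + 1241088*N^2*Z^3 - 5087232*N*Z^4 + 7520256*Z^5"

text \<open>Homogenized Chebyshev polynomials in X = x^2, N = |w|^2: x times \<open>Cheb7\<close> is
  Re w^7 and \<open>Cheb8\<close> is Re w^8, coming from T_7 and T_8.\<close>

definition Cheb7 :: "complex \<Rightarrow> complex \<Rightarrow> complex" where
  "Cheb7 N X = 64*X^3 - 112*X^2*N + 56*X*N^2 - 7*N^3"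

definition Cheb8 :: "complex \<Rightarrow> complex \<Rightarrow> complex" where
  "Cheb8 N X = 128*X^4 - 256*X^3*N + 160*X^2*N^2 - 32*X*N^3 + N^4"

text \<open>The cubic is (X - Z)(X^2 - 6 X Z + Z^2). It divides the left side as a polynomial in X,
  and the long factor is the quotient.\<close>

lemma A1_B1_Cheb:
  assumes "X^3 - 7*X^2*Z + 7*X*Z^2 - Z^3 = 0"
  shows "A1 N (Cheb8 N X) Z + B1 N (Cheb8 N X) Z * Cheb7 N X = 0"
proof -
  have "A1 N (Cheb8 N X) Z + B1 N (Cheb8 N X) Z * Cheb7 N X = (X^3 - 7*X^2*Z + 7*X*Z^2 - Z^3) *
     (25344*N^4 - 95744*N^3*X - 264704*N^3*Z + 138240*N^2*X^2 + 731136*N^2*X*Z + 838656*N^2*Z^2 -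
      92160*N*X^3 - 645120*N*X^2*Z - 1820672*N*X*Z^2 - 260096*N*Z^3 + 24576*X^4 + 172032*X^3*Z +
      1032192*X^2*Z^2 + 172032*X*Z^3 + 24576*Z^4)"
    unfolding A1_def B1_def Cheb7_def Cheb8_def by algebra
  then show ?thesis by (simp add: assms)
qed

lemma A2_B2_Cheb:
  assumes "X^3 - 7*X^2*Z + 7*X*Z^2 - Z^3 = 0"
  shows "A2 N (Cheb8 N X) Z + B2 N (Cheb8 N X) Z * Cheb7 N X = 0"
proof -
  have "A2 N (Cheb8 N X) Z + B2 N (Cheb8 N X) Z * Cheb7 N X = (X^3 - 7*X^2*Z + 7*X*Z^2 - Z^3) *
     (- 165888*N^5 + 852992*N^4*X + 3316736*N^4*Z - 1892352*N^3*X^2 - 11698176*N^3*X*Z - 25239552*N^3*Z^2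
      + 2236416*N^2*X^3 + 15654912*N^2*X^2*Z + 67837952*N^2*X*Z^2 + 69853184*N^2*Z^3 - 1376256*N*X^4 -
      9633792*N*X^3*Z - 57802752*N*X^2*Z^2 - 150011904*N*X*Z^3 - 21430272*N*Z^4 + 344064*X^5 +
      2408448*X^4*Z + 14450688*X^3*Z^2 + 84639744*X^2*Z^3 + 14106624*X*Z^4 + 2015232*Z^5)"
    unfolding A2_def B2_def Cheb7_def Cheb8_def by algebra
  then show ?thesis by (simp add: assms)
qed

definition Nf :: "complex \<Rightarrow> complex \<Rightarrow> complex" where
  "Nf x y = x^2 + y^2"

definition Tf :: "complex \<Rightarrow> complex \<Rightarrow> complex" where
  "Tf x y = x^8 - 28*x^6*y^2 + 70*x^4*y^4 - 28*x^2*y^6 + y^8"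

text \<open>For real x and y, \<open>Uf\<close> and \<open>Vf\<close> are the real and imaginary
  parts of cnj w ^ 7. As polynomials they make sense at complex points too.\<close>

definition Uf :: "complex \<Rightarrow> complex \<Rightarrow> complex" where
  "Uf x y = x^7 - 21*x^5*y^2 + 35*x^3*y^4 - 7*x*y^6"

definition Vf :: "complex \<Rightarrow> complex \<Rightarrow> complex" where
  "Vf x y = y^7 - 21*y^5*x^2 + 35*y^3*x^4 - 7*y*x^6"

definition invf :: "(complex \<Rightarrow> complex \<Rightarrow> complex \<Rightarrow> complex) \<Rightarrow> cfun3" where
  "invf A v = A (Nf (fst v) (fst (snd v))) (Tf (fst v) (fst (snd v))) (snd (snd v) ^ 2)"

definition field_x where
  "field_x A B v = invf A v * fst v + invf B v * Uf (fst v) (fst (snd v))"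

definition field_y where
  "field_y A B v = invf A v * fst (snd v) + invf B v * Vf (fst v) (fst (snd v))"

text \<open>Dihedral symmetry: in each of the four normal directions the same two Chebyshev
  polynomials appear, evaluated at the square of the coordinate along the unit normal. On the
  diagonals that coordinate is (x + y)/\<surd>2 or (x - y)/\<surd>2.\<close>

lemma Cheb_directions:
  "Uf x y = x * Cheb7 (Nf x y) (x^2)" "Tf x y = Cheb8 (Nf x y) (x^2)"
  "Vf x y = y * Cheb7 (Nf x y) (y^2)" "Tf x y = Cheb8 (Nf x y) (y^2)"
  "Uf x y + Vf x y = (x + y) * Cheb7 (Nf x y) ((x + y)^2 / 2)" "Tf x y = Cheb8 (Nf x y) ((x + y)^2 / 2)"
  "Uf x y - Vf x y = (x - y) * Cheb7 (Nf x y) ((x - y)^2 / 2)" "Tf x y = Cheb8 (Nf x y) ((x - y)^2 / 2)"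
proof -
  \<comment> \<open>With X = W/2 all denominators cancel, which leaves polynomial identities for
    \<open>algebra\<close>.\<close>
  have h: "Cheb7 N (W / 2) = 8*W^3 - 28*W^2*N + 28*W*N^2 - 7*N^3"
    "Cheb8 N (W / 2) = 8*W^4 - 32*W^3*N + 40*W^2*N^2 - 16*W*N^3 + N^4" for N W
    by (simp_all add: Cheb7_def Cheb8_def power_divide)
  show "Uf x y = x * Cheb7 (Nf x y) (x^2)" "Tf x y = Cheb8 (Nf x y) (x^2)"
    "Vf x y = y * Cheb7 (Nf x y) (y^2)" "Tf x y = Cheb8 (Nf x y) (y^2)"
    unfolding Uf_def Vf_def Tf_def Nf_def Cheb7_def Cheb8_def by algebra+
  show "Uf x y + Vf x y = (x + y) * Cheb7 (Nf x y) ((x + y)^2 / 2)" "Tf x y = Cheb8 (Nf x y) ((x + y)^2 / 2)"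
    "Uf x y - Vf x y = (x - y) * Cheb7 (Nf x y) ((x - y)^2 / 2)" "Tf x y = Cheb8 (Nf x y) ((x - y)^2 / 2)"
    unfolding h Uf_def Vf_def Tf_def Nf_def by algebra+
qed

lemma offsets_cubic:
  assumes s: "s * s = (2::complex)" and "a \<in> set offsets"
  shows "ev s a = 0 \<or> ((ev s a)^2)^3 - 7 * ((ev s a)^2)^2 + 7 * (ev s a)^2 - 1 = 0"
proof -
  have "ev s a \<in> {0, 1, -1, s - 1, 1 - s, 1 + s, - 1 - s}"
    using assms(2) by (auto simp: offsets_def ev_def)
  moreover have "(s - 1)^2 = 3 - 2 * s" "(1 - s)^2 = 3 - 2 * s" "(1 + s)^2 = 3 + 2 * s" "(- 1 - s)^2 = 3 + 2 * s"
    using s by (simp_all add: power2_eq_square algebra_simps)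
  moreover define p where "p X = X^3 - 7 * X^2 + 7 * X - 1" for X :: complex
  have "p (3 - 2 * s) = 8 * (1 - s) * (s * s - 2)" "p (3 + 2 * s) = 8 * (1 + s) * (s * s - 2)"
    unfolding p_def by algebra+
  then have "p (3 - 2 * s) = 0" "p (3 + 2 * s) = 0" "p 1 = 0" using s by (simp_all add: p_def)
  ultimately have "ev s a = 0 \<or> p ((ev s a)^2) = 0" by auto
  then show ?thesis by (simp only: p_def)
qed

lemma ev_literals:
  "ev s (0,0) = 0" "ev s (1,0) = 1" "ev s (-1,0) = - 1" "ev s (0,-1) = - s" "ev s (-1,1) = s - 1" "ev s (1,-1) = 1 - s"
  by (simp_all add: ev_def)

lemma field_tangent:
  fixes A B :: "complex \<Rightarrow> complex \<Rightarrow> complex \<Rightarrow> complex"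
  assumes s: "s * s = 2"
    and AB: "\<And>N X Z. X^3 - 7*X^2*Z + 7*X*Z^2 - Z^3 = 0 \<Longrightarrow> A N (Cheb8 N X) Z + B N (Cheb8 N X) Z * Cheb7 N X = 0"
    and i: "i < 33" and v: "lf (O33 s i) v = 0"
  shows "O33 s i $ 1 * field_x A B v + O33 s i $ 2 * field_y A B v = 0"
proof -
  obtain x y z where xyz: "v = (x,y,z)" by (cases v)
  let ?A = "A (Nf x y) (Tf x y) (z^2)" and ?B = "B (Nf x y) (Tf x y) (z^2)"
  have fld: "field_x A B v = ?A * x + ?B * Uf x y" "field_y A B v = ?A * y + ?B * Vf x y"
    by (simp_all add: field_x_def field_y_def invf_def xyz)
  \<comment> \<open>Here l is the coordinate along the unit normal and m the same up to a factor s.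
    On a mirror both vanish; otherwise l^2 is a root of the cubic with Z = z^2.\<close>
  have key: "m * (?A + ?B * Cheb7 (Nf x y) (l^2)) = 0"
    if "a \<in> set offsets" "l = ev s a * z" "Tf x y = Cheb8 (Nf x y) (l^2)" "l = 0 \<Longrightarrow> m = 0" for a l m
  proof (cases "ev s a = 0")
    case False
    define b where "b = (ev s a)^2"
    have b: "b^3 - 7 * b^2 + 7 * b - 1 = 0" using offsets_cubic[OF s that(1)] False by (simp add: b_def)
    have l: "l^2 = b * z^2" by (simp add: that(2) b_def power_mult_distrib)
    have "(l^2)^3 - 7*(l^2)^2*z^2 + 7*l^2*(z^2)^2 - (z^2)^3 = 0"
      unfolding l using b by algebra
    from AB[OF this, of "Nf x y"] show ?thesis by (simp add: that(3))
  qed (use that in simp)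
  have s0: "s \<noteq> 0" using s by auto
  have t: "((s - 1)^2)^3 - 7 * ((s - 1)^2)^2 + 7 * (s - 1)^2 - 1 = 0"
    using offsets_cubic[OF s, of "(-1,1)"] ev_eq_0_iff[OF s, of "(-1,1)"] by (simp add: offsets_def ev_literals)
  \<comment> \<open>The right side is u^7 Im (1 + i t)^8, which vanishes for t = tan (k \<pi>/8).
    Hence the slopes of the mirrors satisfy the same cubic as the offsets.\<close>
  have mirror: "t * Uf u (t * u) - Vf u (t * u) = - 8 * t * u^7 * ((t^2)^3 - 7 * (t^2)^2 + 7 * t^2 - 1)"
    "t * Vf (t * u) u - Uf (t * u) u = - 8 * t * u^7 * ((t^2)^3 - 7 * (t^2)^2 + 7 * t^2 - 1)" for t u
    unfolding Uf_def Vf_def by algebra+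
  have "lines ! i \<in> set lines" using i by (simp add: length_lines)
  then consider "lines ! i = ((0,0),(0,0),(1,0))"
    | a where "a \<in> set offsets" "lines ! i = ((1,0), (0,0), zmul (-1,0) a)"
    | a where "a \<in> set offsets" "lines ! i = ((0,0), (1,0), zmul (-1,0) a)"
    | a where "a \<in> set offsets" "lines ! i = ((1,0), (1,0), zmul (0,-1) a)"
    | a where "a \<in> set offsets" "lines ! i = ((1,0), (-1,0), zmul (0,-1) a)"
    | "lines ! i = ((-1,1),(-1,0),(0,0))" | "lines ! i = ((-1,1),(1,0),(0,0))"
    | "lines ! i = ((1,0),(1,-1),(0,0))" | "lines ! i = ((1,0),(-1,1),(0,0))"
    unfolding lines_def by auto
  then show ?thesis
  proof cases
    case 1 then show ?thesis by (simp add: O33_def ev_def)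
  next
    case (2 a)
    have e: "x = ev s a * z"
      using v by (simp add: xyz lf_def O33_def 2 ev_zmul[OF s] ev_literals del: zmul.simps)
    show ?thesis using key[OF 2(1) e Cheb_directions(2), of x]
      unfolding fld O33_def 2 by (simp add: ev_literals Cheb_directions(1) algebra_simps)
  next
    case (3 a)
    have e: "y = ev s a * z"
      using v by (simp add: xyz lf_def O33_def 3 ev_zmul[OF s] ev_literals del: zmul.simps)
    show ?thesis using key[OF 3(1) e Cheb_directions(4), of y]
      unfolding fld O33_def 3 by (simp add: ev_literals Cheb_directions(3) algebra_simps)
  next
    case (4 a)
    have "x + y = s * (ev s a * z)"
      using v by (simp add: xyz lf_def O33_def 4 ev_zmul[OF s] ev_literals algebra_simps del: zmul.simps)
    then have e: "(x + y) / s = ev s a * z" using s0 by simp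
    have sq: "((x + y) / s)^2 = (x + y)^2 / 2" by (simp add: power2_eq_square s)
    have "(x + y) * (?A + ?B * Cheb7 (Nf x y) ((x + y)^2 / 2)) = 0"
      using key[OF 4(1) e, of "x + y"] Cheb_directions(6) s0 by (simp add: sq)
    moreover have "O33 s i $ 1 * field_x A B v + O33 s i $ 2 * field_y A B v = ?A * (x + y) + ?B * (Uf x y + Vf x y)"
      unfolding fld O33_def 4 by (simp add: ev_def algebra_simps)
    ultimately show ?thesis unfolding Cheb_directions(5) by (simp add: algebra_simps)
  next
    case (5 a)
    have "x - y = s * (ev s a * z)"
      using v by (simp add: xyz lf_def O33_def 5 ev_zmul[OF s] ev_literals algebra_simps del: zmul.simps)
    then have e: "(x - y) / s = ev s a * z" using s0 by simp
    have sq: "((x - y) / s)^2 = (x - y)^2 / 2" by (simp add: power2_eq_square s)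
    have "(x - y) * (?A + ?B * Cheb7 (Nf x y) ((x - y)^2 / 2)) = 0"
      using key[OF 5(1) e, of "x - y"] Cheb_directions(8) s0 by (simp add: sq)
    moreover have "O33 s i $ 1 * field_x A B v + O33 s i $ 2 * field_y A B v = ?A * (x - y) + ?B * (Uf x y - Vf x y)"
      unfolding fld O33_def 5 by (simp add: ev_def algebra_simps)
    ultimately show ?thesis unfolding Cheb_directions(7) by (simp add: algebra_simps)
  next
    case 6
    have e: "y = (s - 1) * x" using v by (simp add: xyz lf_def O33_def 6 ev_def algebra_simps)
    have "(s - 1) * Uf x y - Vf x y = 0" using mirror(1)[of "s - 1" x] t e by simp
    moreover have "(s - 1) * x - y = 0" using e by simp
    moreover have "O33 s i $ 1 * field_x A B v + O33 s i $ 2 * field_y A B v =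
      ?A * ((s - 1) * x - y) + ?B * ((s - 1) * Uf x y - Vf x y)"
      unfolding fld O33_def 6 by (simp add: ev_def algebra_simps)
    ultimately show ?thesis by simp
  next
    case 7
    have e: "y = - (s - 1) * x" using v by (simp add: xyz lf_def O33_def 7 ev_def algebra_simps eq_neg_iff_add_eq_0)
    have "(s - 1) * Uf x y + Vf x y = 0"
      using mirror(1)[of "- (s - 1)" x] unfolding e[symmetric] power2_minus t by algebra
    moreover have "(s - 1) * x + y = 0" using e by (simp add: algebra_simps)
    moreover have "O33 s i $ 1 * field_x A B v + O33 s i $ 2 * field_y A B v =
      ?A * ((s - 1) * x + y) + ?B * ((s - 1) * Uf x y + Vf x y)"
      unfolding fld O33_def 7 by (simp add: ev_def algebra_simps)
    ultimately show ?thesis by simp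
  next
    case 8
    have e: "x = (s - 1) * y" using v by (simp add: xyz lf_def O33_def 8 ev_def algebra_simps)
    have "Uf x y - (s - 1) * Vf x y = 0" using mirror(2)[of "s - 1" y] t e by simp
    moreover have "x - (s - 1) * y = 0" using e by simp
    moreover have "O33 s i $ 1 * field_x A B v + O33 s i $ 2 * field_y A B v =
      ?A * (x - (s - 1) * y) + ?B * (Uf x y - (s - 1) * Vf x y)"
      unfolding fld O33_def 8 by (simp add: ev_def algebra_simps)
    ultimately show ?thesis by simp
  next
    case 9
    have e: "x = - (s - 1) * y" using v by (simp add: xyz lf_def O33_def 9 ev_def algebra_simps eq_neg_iff_add_eq_0)
    have "Uf x y + (s - 1) * Vf x y = 0"
      using mirror(2)[of "- (s - 1)" y] unfolding e[symmetric] power2_minus t by algebra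
    moreover have "x + (s - 1) * y = 0" using e by (simp add: algebra_simps)
    moreover have "O33 s i $ 1 * field_x A B v + O33 s i $ 2 * field_y A B v =
      ?A * (x + (s - 1) * y) + ?B * (Uf x y + (s - 1) * Vf x y)"
      unfolding fld O33_def 9 by (simp add: ev_def algebra_simps)
    ultimately show ?thesis by simp
  qed
qed

lemma invariants_scale:
  "Nf (t * x) (t * y) = t^2 * Nf x y" "Tf (t * x) (t * y) = t^8 * Tf x y"
  "Uf (t * x) (t * y) = t^7 * Uf x y" "Vf (t * x) (t * y) = t^7 * Vf x y"
  unfolding Nf_def Tf_def Uf_def Vf_def by algebra+

text \<open>With weights 2, 8, 2 for N, T, Z the two terms of each field have equal degree: 14 + 1 =
  8 + 7 and 16 + 1 = 10 + 7.\<close>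

lemma coefficients_scale:
  "A1 (t^2 * N) (t^8 * T) (t^2 * Z) = t^14 * A1 N T Z" "B1 (t^2 * N) (t^8 * T) (t^2 * Z) = t^8 * B1 N T Z"
  "A2 (t^2 * N) (t^8 * T) (t^2 * Z) = t^16 * A2 N T Z" "B2 (t^2 * N) (t^8 * T) (t^2 * Z) = t^10 * B2 N T Z"
  unfolding A1_def B1_def A2_def B2_def by algebra+

lemma poly3_fields:
  "poly3 (field_x A1 B1)" "poly3 (field_y A1 B1)" "poly3 (field_x A2 B2)" "poly3 (field_y A2 B2)"
  unfolding field_x_def[abs_def] field_y_def[abs_def] invf_def A1_def B1_def A2_def B2_def
    Nf_def Tf_def Uf_def Vf_def
  by (intro poly3_intros)+

lemma hpoly3_fields:
  "hpoly3 15 (field_x A1 B1)" "hpoly3 15 (field_y A1 B1)" "hpoly3 17 (field_x A2 B2)" "hpoly3 17 (field_y A2 B2)"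
proof -
  have sq: "(t * z)^2 = t^2 * z^2" for t z :: complex by (rule power_mult_distrib)
  show "hpoly3 15 (field_x A1 B1)" "hpoly3 15 (field_y A1 B1)" "hpoly3 17 (field_x A2 B2)" "hpoly3 17 (field_y A2 B2)"
    by (rule hpoly3I[OF poly3_fields(1)] hpoly3I[OF poly3_fields(2)] hpoly3I[OF poly3_fields(3)] hpoly3I[OF poly3_fields(4)];
      simp only: field_x_def field_y_def invf_def fst_conv snd_conv invariants_scale sq coefficients_scale; algebra)+
qed

text \<open>The point lies on none of the 32 affine lines, as it must, and on z = 0 only the terms
  free of Z survive.\<close>

lemma fields_independent:
  "field_x A1 B1 (2,1,0) * field_y A2 B2 (2,1,0) \<noteq> field_x A2 B2 (2,1,0) * field_y A1 B1 (2,1,0)"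
  by (simp add: field_x_def field_y_def invf_def Nf_def Tf_def Uf_def Vf_def A1_def B1_def A2_def B2_def)

lemma free_O33:
  assumes s: "s * s = 2"
  shows "free_curve (arr_poly 33 (O33 s)) 15 17"
proof (rule Saito_criterion[OF line_arr_O33[OF s], where e = 0 and w = "(2,1,0)"])
  show "O33 s 0 $ 1 = 0" "O33 s 0 $ 2 = 0" by (simp_all add: O33_def lines_def ev_def)
qed (use field_tangent[OF s] A1_B1_Cheb A2_B2_Cheb hpoly3_fields fields_independent in auto)

section \<open>Rigidity: recovering a realization from its incidences\<close>

definition parallel :: "complex^3 \<Rightarrow> complex^3 \<Rightarrow> bool" where
  "parallel u v \<longleftrightarrow> (\<exists>c. c \<noteq> 0 \<and> u = c *s v)"

lemma cdot_dot3: "cdot u v = dot3 u v"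
  by (simp add: cdot_def dot3_def sum_3)

text \<open>The triple product is the determinant of the three lines; by Cramer's rule it
  annihilates every coordinate of a common point.\<close>

lemma concurrent3_dot3_crossp:
  assumes "concurrent M {a,b,i}"
  shows "dot3 (crossp (M a) (M b)) (M i) = 0"
proof -
  obtain p where p: "p \<noteq> 0" "dot3 (M a) p = 0" "dot3 (M b) p = 0" "dot3 (M i) p = 0"
    using assms by (auto simp: concurrent_def cdot_dot3)
  let ?d = "dot3 (crossp (M a) (M b)) (M i)"
  have "?d * p$1 = 0" "?d * p$2 = 0" "?d * p$3 = 0"
    using p(2-4) unfolding dot3_def crossp_nth by algebra+
  then show ?thesis using p(1) by (auto simp: vec3_eq_iff)
qed

lemma concurrent3I:
  assumes "dot3 (crossp (M a) (M b)) (M i) = 0" "crossp (M a) (M b) \<noteq> 0"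
  shows "concurrent M {a,b,i}"
proof -
  have "dot3 (M a) (crossp (M a) (M b)) = 0" "dot3 (M b) (crossp (M a) (M b)) = 0"
    "dot3 (M i) (crossp (M a) (M b)) = dot3 (crossp (M a) (M b)) (M i)"
    unfolding dot3_def crossp_nth by algebra+
  then show ?thesis using assms unfolding concurrent_def cdot_dot3 by (intro exI[of _ "crossp (M a) (M b)"]) auto
qed

text \<open>The condition \<open>gen\<close> says that the meets of A, B and of C, D are distinct
  points. \<open>X\<close> passes through both by computation and \<open>M i\<close> by concurrency,
  so they are the same line.\<close>

lemma join_unique:
  assumes p: "parallel (M a) A" "parallel (M b) B" "parallel (M c) C" "parallel (M d) D"
    and conc: "concurrent M {a,b,i}" "concurrent M {c,d,i}"
    and nz: "M i \<noteq> 0" "X \<noteq> 0"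
    and X: "dot3 (crossp A B) X = 0" "dot3 (crossp C D) X = 0"
    and gen: "crossp (crossp A B) (crossp C D) \<noteq> 0"
  shows "parallel (M i) X"
proof -
  have *: "dot3 (crossp A B) (M i) = 0"
    if "parallel (M a) A" "parallel (M b) B" "concurrent M {a,b,i}" for a b A B
  proof -
    obtain k l where kl: "k \<noteq> 0" "l \<noteq> 0" "M a = k *s A" "M b = l *s B"
      using \<open>parallel (M a) A\<close> \<open>parallel (M b) B\<close> by (auto simp: parallel_def)
    have "dot3 (crossp (M a) (M b)) (M i) = k * l * dot3 (crossp A B) (M i)"
      by (simp add: kl dot3_def algebra_simps)
    then show ?thesis using concurrent3_dot3_crossp[OF that(3)] kl by simp
  qed
  obtain k where k: "M i = k *s X"
    using orthogonal_two_parallel[OF gen nz(2) *[OF p(1,2) conc(1)] *[OF p(3,4) conc(2)] X] by blast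
  then have "k \<noteq> 0" using nz(1) by (auto simp: vec_eq_iff)
  then show ?thesis using k by (auto simp: parallel_def)
qed

lemma O33_concurrent:
  assumes r: "r * r = 2" and "a < 33" "b < 33" "a \<noteq> b" "zdot (zcross (lines ! a) (lines ! b)) (lines ! i) = (0,0)"
  shows "concurrent (O33 r) {a,b,i}"
proof (rule concurrent3I)
  show "crossp (O33 r a) (O33 r b) \<noteq> 0" using O33_crossp_nonzero assms by blast
  show "dot3 (crossp (O33 r a) (O33 r b)) (O33 r i) = 0"
    by (simp add: O33_def crossp_evv[OF r] dot3_evv[OF r] assms(5) ev_def)
qed

text \<open>A step \<open>(i, a, b, c, d)\<close> recovers line \<open>i\<close> as the line joining the intersection point of the lines
  \<open>a\<close>, \<open>b\<close> with that of the lines \<open>c\<close>, \<open>d\<close>.\<close>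

fun constructible :: "nat list \<Rightarrow> (nat \<times> nat \<times> nat \<times> nat \<times> nat) list \<Rightarrow> bool" where
  "constructible K [] = list_all (\<lambda>i. i \<in> set K) [0..<33]"
| "constructible K ((i,a,b,c,d) # st) =
    (i < 33 \<and> a \<in> set K \<and> b \<in> set K \<and> c \<in> set K \<and> d \<in> set K \<and> a \<noteq> b \<and> c \<noteq> d \<and>
     zdot (zcross (lines ! a) (lines ! b)) (lines ! i) = (0,0) \<and>
     zdot (zcross (lines ! c) (lines ! d)) (lines ! i) = (0,0) \<and>
     zcross (zcross (lines ! a) (lines ! b)) (zcross (lines ! c) (lines ! d)) \<noteq> zzero \<and>
     constructible (i # K) st)"

text \<open>Two roots of 2 are in play: \<open>r\<close> belongs to the arrangement whose incidences
  \<open>N\<close> inherits, \<open>s\<close> to the coordinates that \<open>N\<close> turns out to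
  have. The checks in \<open>constructible\<close> are made in \<open>z2\<close> and hold for
  both.\<close>

lemma constructible_parallel:
  assumes r: "r * r = 2" and s: "s * s = 2" and N: "line_arr 33 N"
    and conc: "\<And>S. S \<subseteq> {..<33} \<Longrightarrow> concurrent (O33 r) S \<Longrightarrow> concurrent N S"
  shows "constructible K st \<Longrightarrow> set K \<subseteq> {..<33} \<Longrightarrow> (\<And>i. i \<in> set K \<Longrightarrow> parallel (N i) (O33 s i))
    \<Longrightarrow> i < 33 \<Longrightarrow> parallel (N i) (O33 s i)"
proof (induction K st rule: constructible.induct)
  case (1 K)
  then show ?case by (simp add: list_all_iff)
next
  case (2 K j a b c d st)
  have K: "a \<in> set K" "b \<in> set K" "c \<in> set K" "d \<in> set K" and j: "j < 33" and ne: "a \<noteq> b" "c \<noteq> d"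
    and z: "zdot (zcross (lines ! a) (lines ! b)) (lines ! j) = (0,0)"
     "zdot (zcross (lines ! c) (lines ! d)) (lines ! j) = (0,0)"
     "zcross (zcross (lines ! a) (lines ! b)) (zcross (lines ! c) (lines ! d)) \<noteq> zzero"
    and st: "constructible (j # K) st"
    using "2.prems"(1) by auto
  have lt: "a < 33" "b < 33" "c < 33" "d < 33" using K "2.prems"(2) by auto
  have "parallel (N j) (O33 s j)"
  proof (rule join_unique[of N a "O33 s a" b "O33 s b" c "O33 s c" d "O33 s d"])
    show "concurrent N {a,b,j}" "concurrent N {c,d,j}"
      using O33_concurrent[OF r lt(1,2) ne(1) z(1)] O33_concurrent[OF r lt(3,4) ne(2) z(2)] lt j
      by (auto intro!: conc)
    show "N j \<noteq> 0" using N j by (auto simp: line_arr_def)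
    show "O33 s j \<noteq> 0" by (rule O33_nonzero[OF s j])
    show "dot3 (crossp (O33 s a) (O33 s b)) (O33 s j) = 0" "dot3 (crossp (O33 s c) (O33 s d)) (O33 s j) = 0"
      by (simp_all add: O33_def crossp_evv[OF s] dot3_evv[OF s] z ev_def)
    show "crossp (crossp (O33 s a) (O33 s b)) (crossp (O33 s c) (O33 s d)) \<noteq> 0"
      using z(3) by (simp add: O33_def crossp_evv[OF s] evv_eq_0_iff[OF s])
  qed (use "2.prems"(3) K in blast)+
  then have "\<And>i. i \<in> set (j # K) \<Longrightarrow> parallel (N i) (O33 s i)" using "2.prems"(3) by auto
  moreover have "set (j # K) \<subseteq> {..<33}" using "2.prems"(2) j by simp
  ultimately show ?case using "2.IH" K j ne z st "2.prems"(4) by blast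
qed

definition construction_steps :: "(nat \<times> nat \<times> nat \<times> nat \<times> nat) list" where
  "construction_steps = [(11,0,8,4,22), (16,2,11,4,9), (23,0,22,8,16), (24,0,22,1,16), (25,0,22,2,11),
    (26,0,22,4,9), (29,1,8,2,11), (30,1,8,2,23), (31,1,8,2,24), (32,1,8,4,23), (3,0,1,11,24), (5,0,1,9,24),
    (6,0,1,9,23), (7,0,1,9,30), (10,0,8,3,22), (12,0,8,2,23), (13,0,8,2,24), (14,0,8,2,32), (15,0,16,1,8),
    (17,0,15,1,23), (18,0,15,1,26), (19,0,15,1,25), (20,0,15,2,13), (21,0,15,3,14), (27,0,22,1,21),
    (28,0,22,1,20)]"

lemma constructible_construction_steps: "constructible [0,1,8,22,2,9,4] construction_steps"
  by code_simp

lemma O33_values: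
  "O33 s 0 = vector [0,0,1]" "O33 s 1 = vector [1,0,0]" "O33 s 8 = vector [0,1,0]" "O33 s 22 = vector [1,-1,0]"
  "O33 s 2 = vector [1,0,-1]" "O33 s 9 = vector [0,1,-1]" "O33 s 4 = vector [1,0,1-s]"
  by (simp_all add: O33_def lines_def offsets_def vec3_eq_iff ev_def)

lemma realization_with_standard_frame:
  assumes r: "r * r = 2" and N: "line_arr 33 N"
    and conc: "\<And>S. S \<subseteq> {..<33} \<Longrightarrow> concurrent (O33 r) S \<Longrightarrow> concurrent N S"
    and frame: "parallel (N 0) (vector [0,0,1])" "parallel (N 1) (vector [1,0,0])"
      "parallel (N 8) (vector [0,1,0])" "parallel (N 22) (vector [1,-1,0])" "parallel (N 2) (vector [1,0,-1])"
  shows "\<exists>s. s * s = 2 \<and> (\<forall>i<33. parallel (N i) (O33 s i))"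
proof -
  have nz: "N i \<noteq> 0" if "i < 33" for i using N that by (auto simp: line_arr_def)
  have indep: "\<nexists>c. N i = c *s N j" if "i < 33" "j < 33" "i \<noteq> j" for i j
    using N that by (auto simp: line_arr_def)
  have c3: "concurrent N {a,b,i}"
    if "a < 33" "b < 33" "i < 33" "a \<noteq> b" "zdot (zcross (lines ! a) (lines ! b)) (lines ! i) = (0,0)" for a b i
    using O33_concurrent[OF r that(1,2,4,5)] that by (intro conc) auto
  have conc0: "concurrent N {0,8,9}" "concurrent N {2,22,9}" "concurrent N {0,1,4}" "concurrent N {0,8,11}"
    "concurrent N {4,22,11}" "concurrent N {2,11,16}" "concurrent N {4,9,16}" "concurrent N {0,22,23}"
    "concurrent N {8,16,23}" "concurrent N {0,1,6}" "concurrent N {9,23,6}" "concurrent N {1,8,29}"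
    "concurrent N {2,11,29}" "concurrent N {9,6,29}"
    by (rule c3; simp add: lines_def offsets_def)+
  \<comment> \<open>In the chart z = 1 this is y = 1, the horizontal line through the meet (1,1) of
    x = 1 and x = y.\<close>
  have n9: "parallel (N 9) (vector [0,1,-1])"
    by (rule join_unique[OF frame(1,3) frame(5,4) conc0(1,2) nz])
      (simp_all add: dot3_def vec3_eq_iff)
  obtain k0 where k0: "k0 \<noteq> 0" "N 0 = k0 *s vector [0,0,1]" using frame(1) by (auto simp: parallel_def)
  obtain k1 where k1: "k1 \<noteq> 0" "N 1 = k1 *s vector [1,0,0]" using frame(2) by (auto simp: parallel_def)
  obtain k2 where k2: "k2 \<noteq> 0" "N 2 = k2 *s vector [1,0,-1]" using frame(5) by (auto simp: parallel_def)
  have y0: "N 4 $ 2 = 0"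
    using concurrent3_dot3_crossp[OF conc0(3)] k0(1) k1(1) by (simp add: k0(2) k1(2) dot3_def del: One_nat_def)
  have x0: "N 4 $ 1 \<noteq> 0"
  proof
    assume "N 4 $ 1 = 0"
    then have "N 4 = (N 4 $ 3 / k0) *s N 0" using y0 k0 by (simp add: vec3_eq_iff)
    then have "\<exists>c. N 4 = c *s N 0" by blast
    then show False using indep[of 4 0] by (simp del: One_nat_def)
  qed
  define t where "t = - N 4 $ 3 / N 4 $ 1"
  have n4: "parallel (N 4) (vector [1,0,-t])"
    unfolding parallel_def using x0 y0 by (intro exI[of _ "N 4 $ 1"]) (simp add: vec3_eq_iff t_def)
  have t1: "t \<noteq> 1"
  proof
    assume "t = 1"
    then have "- N 4 $ 3 = N 4 $ 1" using x0 by (simp add: t_def field_simps)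
    then have "N 4 $ 3 = - N 4 $ 1" by (metis minus_minus)
    then have "N 4 = (N 4 $ 1 / k2) *s N 2" using y0 k2 by (simp add: vec3_eq_iff)
    then have "\<exists>c. N 4 = c *s N 2" by blast
    then show False using indep[of 4 2] by (simp del: One_nat_def)
  qed
  have n11: "parallel (N 11) (vector [0,1,-t])"
    by (rule join_unique[OF frame(1,3) n4 frame(4) conc0(4,5) nz])
      (simp_all add: dot3_def vec3_eq_iff)
  have n16: "parallel (N 16) (vector [1,1,-(1+t)])"
    by (rule join_unique[OF frame(5) n11 n4 n9 conc0(6,7) nz])
      (use t1 in \<open>simp_all add: dot3_def vec3_eq_iff algebra_simps\<close>)
  have n23: "parallel (N 23) (vector [1,-1,-(1+t)])"
    by (rule join_unique[OF frame(1,4) frame(3) n16 conc0(8,9) nz])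
      (simp_all add: dot3_def vec3_eq_iff)
  have n6: "parallel (N 6) (vector [1,0,-(2+t)])"
    by (rule join_unique[OF frame(1,2) n9 n23 conc0(10,11) nz])
      (simp_all add: dot3_def vec3_eq_iff algebra_simps)
  have n29: "parallel (N 29) (vector [t,-1,0])"
    by (rule join_unique[OF frame(2,3) frame(5) n11 conc0(12,13) nz])
      (simp_all add: dot3_def vec3_eq_iff)
  obtain a where a: "a \<noteq> 0" "N 9 = a *s vector [0,1,-1]" using n9 by (auto simp: parallel_def)
  obtain b where b: "b \<noteq> 0" "N 6 = b *s vector [1,0,-(2+t)]" using n6 by (auto simp: parallel_def)
  obtain c where c: "c \<noteq> 0" "N 29 = c *s vector [t,-1,0]" using n29 by (auto simp: parallel_def)
  have "dot3 (crossp (N 9) (N 6)) (N 29) = a * b * c * (1 - t * (2 + t))"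
    by (simp add: a(2) b(2) c(2) dot3_def algebra_simps)
  then have "t * (2 + t) = 1" using concurrent3_dot3_crossp[OF conc0(14)] a b c by simp
  then have s: "(1 + t) * (1 + t) = 2" by (simp add: algebra_simps)
  have "parallel (N i) (O33 (1 + t) i)" if "i \<in> set [0,1,8,22,2,9,4]" for i
    using that frame n9 n4 by (auto simp: O33_values simp del: One_nat_def)
  then have "\<forall>i<33. parallel (N i) (O33 (1 + t) i)"
    using constructible_parallel[OF r s N conc constructible_construction_steps] by auto
  then show ?thesis using s by blast
qed

lemma Cramer_expansion:
  fixes u v w x :: "complex^3"
  shows "dot3 (crossp u v) w *s x =
    dot3 (crossp x v) w *s u + dot3 (crossp u x) w *s v + dot3 (crossp u v) x *s w"
  unfolding vec3_eq_iff by (simp add: dot3_def algebra_simps)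

lemma realization_proj_equiv:
  assumes r: "r * r = 2" and M: "line_arr 33 M" and lat: "same_lattice 33 (O33 r) M"
  shows "\<exists>s. s * s = 2 \<and> proj_equiv 33 (O33 s) M"
proof -
  have lat': "concurrent (O33 r) S \<longleftrightarrow> concurrent M S" if "S \<subseteq> {..<33}" for S
    using lat that by (simp add: same_lattice_def)
  have nz: "M i \<noteq> 0" if "i < 33" for i using M that by (auto simp: line_arr_def)
  have indep: "\<nexists>c. M i = c *s M j" if "i < 33" "j < 33" "i \<noteq> j" for i j
    using M that by (auto simp: line_arr_def)
  define u v w where "u = M 1" and "v = M 8" and "w = M 0"
  have D: "dot3 (crossp u v) w \<noteq> 0"
  proof
    assume "dot3 (crossp u v) w = 0"
    moreover have "crossp u v \<noteq> 0"
      using crossp_eq_0_dependent[of u v] indep[of 1 8] nz[of 8] by (auto simp: u_def v_def)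
    ultimately have "concurrent M {1,8,0}" by (intro concurrent3I) (simp_all add: u_def v_def w_def)
    then have "concurrent (O33 r) {1,8,0}" using lat' by auto
    then show False using concurrent3_dot3_crossp[of "O33 r" 1 8 0] by (simp add: O33_values dot3_def del: One_nat_def)
  qed
  have "concurrent M {1,8,22}" "concurrent M {1,0,2}"
    using lat'[of "{1,8,22}"] lat'[of "{1,0,2}"] O33_concurrent[OF r, of 1 8 22] O33_concurrent[OF r, of 1 0 2]
    by (simp_all add: lines_def offsets_def)
  note conc = this[THEN concurrent3_dot3_crossp]
  define \<alpha> \<beta> \<gamma> \<delta> where "\<alpha> = dot3 (crossp (M 22) v) w" and "\<beta> = dot3 (crossp u (M 22)) w"
    and "\<gamma> = dot3 (crossp (M 2) v) w" and "\<delta> = dot3 (crossp u v) (M 2)"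
  define D' where "D' = dot3 (crossp u v) w"
  have m22: "D' *s M 22 = \<alpha> *s u + \<beta> *s v"
    using Cramer_expansion[of u v w "M 22"] conc(1) by (simp add: \<alpha>_def \<beta>_def D'_def u_def v_def)
  have "dot3 (crossp u (M 2)) w = - dot3 (crossp u w) (M 2)"
    by (simp add: dot3_def algebra_simps)
  then have m2: "D' *s M 2 = \<gamma> *s u + \<delta> *s w"
    using Cramer_expansion[of u v w "M 2"] conc(2) by (simp add: \<gamma>_def \<delta>_def D'_def u_def w_def)
  have D'0: "D' \<noteq> 0" using D by (simp add: D'_def)
  have div: "x = (k / D') *s y" if "D' *s x = k *s y" for x y :: "complex^3" and k
    using that D'0 by (simp add: vec_eq_iff field_simps)
  have \<alpha>: "\<alpha> \<noteq> 0"
  proof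
    assume "\<alpha> = 0"
    then have "M 22 = (\<beta> / D') *s M 8" using m22 by (intro div) (simp add: v_def)
    then have "\<exists>c. M 22 = c *s M 8" by blast
    then show False using indep[of 22 8] by (simp del: One_nat_def)
  qed
  have \<beta>: "\<beta> \<noteq> 0"
  proof
    assume "\<beta> = 0"
    then have "M 22 = (\<alpha> / D') *s M 1" using m22 by (intro div) (simp add: u_def)
    then have "\<exists>c. M 22 = c *s M 1" by blast
    then show False using indep[of 22 1] by (simp del: One_nat_def)
  qed
  have \<gamma>: "\<gamma> \<noteq> 0"
  proof
    assume "\<gamma> = 0"
    then have "M 2 = (\<delta> / D') *s M 0" using m2 by (intro div) (simp add: w_def)
    then have "\<exists>c. M 2 = c *s M 0" by blast
    then show False using indep[of 2 0] by (simp del: One_nat_def)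
  qed
  have \<delta>: "\<delta> \<noteq> 0"
  proof
    assume "\<delta> = 0"
    then have "M 2 = (\<gamma> / D') *s M 1" using m2 by (intro div) (simp add: u_def)
    then have "\<exists>c. M 2 = c *s M 1" by blast
    then show False using indep[of 2 1] by (simp del: One_nat_def)
  qed
  \<comment> \<open>Chosen so that \<alpha> u + \<epsilon> w is proportional to \<gamma> u +
    \<delta> w. The matrix below has columns \<alpha> u, -\<beta> v, -\<epsilon> w and thus sends
    (1,-1,0) and (1,0,-1) to multiples of \<open>M 22\<close> and \<open>M 2\<close>.\<close>
  define \<epsilon> where "\<epsilon> = \<alpha> * \<delta> / \<gamma>"
  have \<epsilon>: "\<epsilon> \<noteq> 0" using \<alpha> \<gamma> \<delta> by (simp add: \<epsilon>_def)
  define A :: "complex^3^3" where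
    "A = (\<chi> i. vector [\<alpha> * u$i, - \<beta> * v$i, - \<epsilon> * w$i])"
  have Av: "A *v y = (\<alpha> * y$1) *s u + (- \<beta> * y$2) *s v + (- \<epsilon> * y$3) *s w" for y
    by (simp add: A_def matrix_vector_mult_def vec_eq_iff sum_3 algebra_simps)
  have "det A = \<alpha> * \<beta> * \<epsilon> * D'"
    by (simp add: det_3 A_def D'_def dot3_def algebra_simps)
  then have inv: "invertible A" using \<alpha> \<beta> \<epsilon> D'0 by (simp add: invertible_det_nz)
  then obtain A' where A': "A ** A' = mat 1" "A' ** A = mat 1" by (auto simp: invertible_def)
  define N where "N i = A' *v M i" for i
  have AN: "A *v N i = M i" for i
    by (simp add: N_def matrix_vector_mul_assoc A'(1))
  have inj: "x = y" if "A *v x = A *v y" for x y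
  proof -
    have "A' *v (A *v x) = A' *v (A *v y)" using that by simp
    then show ?thesis by (simp add: matrix_vector_mul_assoc A'(2))
  qed
  have Asc: "A *v (c *s x) = c *s (A *v x)" for c x
    by (simp add: Av vec_eq_iff algebra_simps)
  have N: "line_arr 33 N"
    unfolding line_arr_def
  proof (intro conjI allI impI)
    fix i :: nat assume "i < 33"
    then show "N i \<noteq> 0" using AN[of i] nz[of i] by auto
  next
    fix i j :: nat assume ij: "i < 33" "j < 33" "i \<noteq> j"
    show "\<nexists>c. N i = c *s N j"
    proof
      assume "\<exists>c. N i = c *s N j"
      then obtain c where "N i = c *s N j" by blast
      then have "A *v N i = c *s (A *v N j)" by (simp only: Asc)
      then show False using indep[OF ij] unfolding AN by blast
    qed
  qed
  have concN: "concurrent N S" if S: "S \<subseteq> {..<33}" "concurrent (O33 r) S" for S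
  proof -
    obtain p where p: "p \<noteq> 0" "\<And>i. i \<in> S \<Longrightarrow> dot3 (M i) p = 0"
      using lat'[OF S(1)] S(2) by (auto simp: concurrent_def cdot_dot3)
    \<comment> \<open>Lines are moved by the inverse of \<open>A\<close>, so common points are moved
      by its transpose.\<close>
    have tr: "dot3 (A *v x) p = dot3 x (transpose A *v p)" for x
      by (simp add: dot3_def matrix_vector_mult_def transpose_def sum_3 algebra_simps)
    have "transpose A *v p \<noteq> 0"
    proof
      assume 0: "transpose A *v p = 0"
      have "p $ k = dot3 (A *v (A' *v axis k 1)) p" for k
        using exhaust_3[of k] unfolding matrix_vector_mul_assoc A'(1)
        by (auto simp: dot3_def axis_def)
      then show False using p(1) unfolding tr 0 by (simp add: vec_eq_iff dot3_def)
    qed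
    moreover have "dot3 (N i) (transpose A *v p) = 0" if "i \<in> S" for i
      using p(2)[OF that] unfolding tr[symmetric] AN .
    ultimately show ?thesis unfolding concurrent_def cdot_dot3 by blast
  qed
  have par: "parallel (N i) x" if "M i = c *s (A *v x)" "c \<noteq> 0" for i c x
  proof -
    have "A *v N i = A *v (c *s x)" unfolding AN Asc by (rule that(1))
    then show ?thesis unfolding parallel_def using inj that(2) by blast
  qed
  have "\<exists>s. s * s = 2 \<and> (\<forall>i<33. parallel (N i) (O33 s i))"
  proof (rule realization_with_standard_frame[OF r N concN])
    show "parallel (N 0) (vector [0,0,1])"
      by (rule par[of _ "- 1 / \<epsilon>"]) (use \<epsilon> in \<open>simp_all add: Av vec_eq_iff w_def\<close>)
    show "parallel (N 1) (vector [1,0,0])"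
      by (rule par[of _ "1 / \<alpha>"]) (use \<alpha> in \<open>simp_all add: Av vec_eq_iff u_def\<close>)
    show "parallel (N 8) (vector [0,1,0])"
      by (rule par[of _ "- 1 / \<beta>"]) (use \<beta> in \<open>simp_all add: Av vec_eq_iff v_def\<close>)
    show "parallel (N 22) (vector [1,-1,0])"
    proof (rule par)
      have "D' *s M 22 = 1 *s (A *v vector [1,-1,0])" by (simp add: m22 Av vec_eq_iff)
      then show "M 22 = (1 / D') *s (A *v vector [1,-1,0])" by (rule div)
    qed (use D'0 in simp)
    show "parallel (N 2) (vector [1,0,-1])"
    proof (rule par)
      have "D' *s M 2 = (\<gamma> / \<alpha>) *s (A *v vector [1,0,-1])"
        unfolding m2 Av using \<alpha> \<gamma> by (simp add: vec_eq_iff \<epsilon>_def field_simps)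
      then show "M 2 = (\<gamma> / \<alpha> / D') *s (A *v vector [1,0,-1])" by (rule div)
    qed (use D'0 \<alpha> \<gamma> in simp)
  qed
  then obtain s where s: "s * s = 2" "\<And>i. i < 33 \<Longrightarrow> parallel (N i) (O33 s i)" by blast
  have "\<exists>c. c \<noteq> 0 \<and> M i = c *s (A *v O33 s i)" if "i < 33" for i
  proof -
    obtain c where "c \<noteq> 0" "N i = c *s O33 s i" using s(2) \<open>i < 33\<close> by (auto simp: parallel_def)
    then show ?thesis unfolding AN[of i, symmetric] by (auto simp: Asc)
  qed
  then show ?thesis using s(1) inv unfolding proj_equiv_def by blast
qed

lemma rigid_O33:
  assumes r: "r * r = 2"
  shows "rigid 33 (O33 r)"
  unfolding rigid_def
proof (intro conjI exI[of _ "{O33 r, O33 (- r)}"] allI impI)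
  fix M assume "line_arr 33 M \<and> same_lattice 33 (O33 r) M"
  then obtain s where s: "s * s = 2" "proj_equiv 33 (O33 s) M" using realization_proj_equiv[OF r] by blast
  have "(s - r) * (s + r) = 0" using s(1) r by (simp add: algebra_simps)
  then have "s = r \<or> s = - r" by (auto simp: add_eq_0_iff2)
  then show "\<exists>M'\<in>{O33 r, O33 (- r)}. proj_equiv 33 M' M" using s(2) by auto
qed (simp_all add: line_arr_O33[OF r])

theorem theoremB:
  shows "\<exists>L :: nat \<Rightarrow> real^3.
     line_arr 33 (cplx L) \<and>
     nk 33 L 2 = 108 \<and> nk 33 L 3 = 40 \<and> nk 33 L 5 = 16 \<and> nk 33 L 8 = 5 \<and>
     (\<forall>k. 2 \<le> k \<and> k \<notin> {2,3,5,8} \<longrightarrow> nk 33 L k = 0) \<and>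
     rigid 33 (cplx L) \<and>
     free_curve (arr_poly 33 (cplx L)) 15 17"
proof -
  have s: "complex_of_real (sqrt 2) * complex_of_real (sqrt 2) = 2"
    by (simp flip: of_real_mult)
  show ?thesis
    by (intro exI[of _ "O33 (sqrt 2)"] conjI)
      (use nk_O33_values line_arr_O33[OF s] rigid_O33[OF s] free_O33[OF s] in \<open>auto simp: cplx_O33\<close>)
qed

end
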